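(* Let $X$ be a real normed space of finite dimension $d$ and let $S$ be a set with $d+1\le|S|<\infty$. Then the set $\operatorname{Full}(S)$ of full placements of $S$ in $X$ is an open dense subset of $X^S$, and its complement $X^S\setminus\operatorname{Full}(S)$ has measure zero with respect to the Lebesgue measure on $X^S$.
   Context: $\operatorname{Isom}(X)$ is the group of isometries of $X$; every isometry of $X$ is affine, $\operatorname{Isom}(X)$ has the topology inherited from the finite dimensional space $A(X)$ of affine maps $X\to X$, and it is a Lie group. A placement of a set $S$ in $X$ is $p=(p_v)_{v\in S}\in X^S$. For $g\in A(X)$, $x\in X^S$ put $g.x:=(g(x_v))_{v\in S}$. The orbit is $\mathcal{O}_p=\{g.p:g\in\operatorname{Isom}(X)\}$, which for finite $S$ is a closed smooth submanifold of $X^S$, and $\phi_p:\operatorname{Isom}(X)\to\mathcal{O}_p$, $g\mapsto g.p$. A placement $p$ is full if $\phi_p$ is a smooth local diffeomorphism, i.e. $d\phi_p(g)$ is bijective for all $g\in\operatorname{Isom}(X)$. *)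

theory Defs
  imports "HOL-Analysis.Analysis"
begin

definition isometries :: "('a::metric_space \<Rightarrow> 'a) set"
  where "isometries = {f. surj f \<and> (\<forall>x y. dist (f x) (f y) = dist x y)}"

(* The space A(X) of affine maps on a finite-dimensional normed space X: the pair (b, L)
   stands for x \<mapsto> b + L x.  All linear maps on X are bounded, so every affine map
   arises from exactly one pair. *)
type_synonym 'a affine_map = "'a \<times> ('a \<Rightarrow>\<^sub>L 'a)"

definition affine_apply :: "'a::real_normed_vector affine_map \<Rightarrow> 'a \<Rightarrow> 'a"
  where "affine_apply g x = fst g + blinfun_apply (snd g) x"

(* Isom(X) as a subset of A(X); nothing is lost, since isometries are affine (Mazur-Ulam). *)
definition Isom :: "'a::real_normed_vector affine_map set"
  where "Isom = {g. affine_apply g \<in> isometries}"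

(* A placement of S in X is an element of 'a ^ 's, where the finite type 's is the set S. *)
definition act :: "'a::real_normed_vector affine_map \<Rightarrow> 'a ^ 's \<Rightarrow> 'a ^ 's"
  where "act g p = (\<chi> v. affine_apply g (p $ v))"

definition orbit :: "'a::real_normed_vector ^ 's \<Rightarrow> ('a ^ 's) set"
  where "orbit p = (\<lambda>g. act g p) ` Isom"

(* c is infinitely differentiable on (-e, e); D n is its n-th derivative. *)
definition smooth_curve :: "real \<Rightarrow> (real \<Rightarrow> 'v::real_normed_vector) \<Rightarrow> bool"
  where "smooth_curve e c \<longleftrightarrow>
    (\<exists>D. D 0 = c \<and>
      (\<forall>n. \<forall>t\<in>{-e<..<e}. (D n has_vector_derivative D (Suc n) t) (at t)))"

(* The tangent space at x of an embedded submanifold M of a finite-dimensional normed space. *)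
definition tangent_space :: "'v::real_normed_vector set \<Rightarrow> 'v \<Rightarrow> 'v set"
  where "tangent_space M x =
    {w. \<exists>e>0. \<exists>c. smooth_curve e c \<and> c ` {-e<..<e} \<subseteq> M \<and> c 0 = x \<and>
        (c has_vector_derivative w) (at 0)}"

(* The orbit map of p is the restriction to Isom(X) of the map h \<mapsto> act h p on all of A(X).
   Its differential at g is therefore the restriction of the Frechet derivative of the latter
   to a map from the tangent space of Isom(X) at g to that of the orbit at act g p. *)
definition full_placement :: "'a::real_normed_vector ^ 's \<Rightarrow> bool"
  where "full_placement p \<longleftrightarrow>
    (\<forall>g\<in>Isom. bij_betw (frechet_derivative (\<lambda>h. act h p) (at g))
       (tangent_space Isom g) (tangent_space (orbit p) (act g p)))"

definition Full :: "('a::real_normed_vector ^ 's) set"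
  where "Full = {p. full_placement p}"

(* The Lebesgue measure on a finite-dimensional normed space, normalised so that the
   parallelepiped spanned by the basis B has measure 1.  Different bases give measures
   differing by a positive factor. *)
definition lebesgue_basis :: "'v::real_normed_vector set \<Rightarrow> 'v measure"
  where "lebesgue_basis B =
    completion (distr (Pi\<^sub>M B (\<lambda>_. lborel)) borel (\<lambda>c. \<Sum>b\<in>B. c b *\<^sub>R b))"

end

theory Submission
  imports Defs
begin

text \<open>
  Isometries of $X$ are the affine maps $x \mapsto b + L x$ with $L$ a linear isometry.  The
  tangent space of this group at $(b, L)$ consists of the pairs $(w, L W)$, where $w$ is any vector
  and $W$ is any conservative operator, that is, $\|y + s W y\| = \|y\| + o(s)$ for all $y$: velocities
  of curves of isometries have this form, and for conservative $W$ the exponentials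
  $e^{t W}$ are isometries, because $\|e^{t W} x\|$ has derivative zero
  (lemma \<open>tangent_space_Isom\<close>).

  The differential of $h \mapsto h . p$ sends $(w, L W)$ to $(w + L W p_v)_v$.  It is injective iff
  no nonzero conservative $W$ kills all differences $p_v - p_{v'}$, a condition on $p$ alone.  Under this
  condition it also maps onto the tangent space of the orbit
  (lemma \<open>infinitesimally_free_imp_full_placement\<close>): orbit points close to $g . p$ come from
  isometries that, after passing to a subsequence and correcting by the stabiliser of $p$, tend
  to $g$, and if their difference quotients were unbounded, then a rescaled limit would be a
  nonzero conservative operator that kills all differences (lemma
  \<open>isometry_path_velocity\<close>).  Hence $p$ is full iff it is infinitesimally free.

  Openness is now compactness of the unit sphere in the closed space of conservative operators.
  For density and measure zero, choose a placement $q$ that contains $0$ and a basis of $X$ among its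
  entries.  If $p + t q$ fails the condition, then $-t$ is an eigenvalue of a linear map
  on the space of operators that depends only on $p$, so only finitely many $t$ fail (lemma
  \<open>infinitesimally_free_generic_on_lines\<close>).  Thus full placements are dense, and the closed
  set of non-full ones meets every line in direction $q$ in a finite set, so it is null by
  translation invariance and Tonelli's theorem (lemma
  \<open>null_if_null_on_parallel_lines\<close>).
\<close>

section \<open>Coordinates in a finite-dimensional normed space\<close>

text \<open>
  A finite basis is all that is known about the space $X$: its norm need not come from an inner
  product.  Compactness of balls, continuity of linear maps and convergence of series are
  therefore derived from coordinates.  The locale is also used for the space of operators on
  $X$ and, in the measure-theoretic part, for the space of placements.
\<close>
locale finite_basis =
  fixes B :: "'v::real_normed_vector set"
  assumes finite_B: "finite B" and independent_B: "independent B" and span_B: "span B = UNIV"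
begin

abbreviation coord :: "'v \<Rightarrow> 'v \<Rightarrow> real"
  where "coord b x \<equiv> representation B x b"

lemma sum_coord: "(\<Sum>b\<in>B. coord b x *\<^sub>R b) = x"
  using real_vector.sum_representation_eq[OF independent_B, of x B] finite_B span_B by simp

lemma coord_unique:
  assumes "(\<Sum>b\<in>B. c b *\<^sub>R b) = 0" "b \<in> B"
  shows "c b = 0"
  using assms finite_B independent_B by (metis independentD subset_refl)

lemma linear_coord: "linear (coord b)"
  by (rule linearI)
     (simp_all add: real_vector.representation_add real_vector.representation_scale
        independent_B span_B)

lemma coord_basis: "b \<in> B \<Longrightarrow> coord b' b = (if b' = b then 1 else 0)"
  by (simp add: real_vector.representation_basis independent_B)

lemma combination_continuous:
  "continuous_on UNIV (\<lambda>c::'v \<Rightarrow> real. \<Sum>b\<in>B. c b *\<^sub>R b)"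
  by (intro continuous_intros continuous_on_product_coordinates)

lemma compact_coefficient_box:
  "compact {c::'v \<Rightarrow> real. (\<forall>b\<in>B. \<bar>c b\<bar> \<le> r) \<and> (\<forall>b. b \<notin> B \<longrightarrow> c b = 0)}"
proof -
  have "compactin (product_topology (\<lambda>_. euclidean) UNIV)
      (PiE UNIV (\<lambda>b::'v. if b \<in> B then {-r..r} else {0::real}))"
    by (auto simp: compactin_PiE)
  moreover have "PiE UNIV (\<lambda>b::'v. if b \<in> B then {-r..r} else {0::real})
      = {c. (\<forall>b\<in>B. \<bar>c b\<bar> \<le> r) \<and> (\<forall>b. b \<notin> B \<longrightarrow> c b = 0)}"
    by (auto simp: PiE_def Pi_def abs_le_iff split: if_splits; force)
  ultimately show ?thesis
    by (simp add: euclidean_product_topology)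
qed

text \<open>
  Equivalence of norms: the continuous function $c \mapsto \|\sum_b c_b b\|$ has a positive
  minimum on the compact set of coefficient families with $\sum_b |c_b| = 1$, because the
  basis is independent.
\<close>
lemma coord_bounded: "\<exists>C>0. \<forall>x. \<forall>b\<in>B. \<bar>coord b x\<bar> \<le> C * norm x"
proof -
  define S where "S = {c::'v \<Rightarrow> real. (\<forall>b\<in>B. \<bar>c b\<bar> \<le> 1) \<and> (\<forall>b. b \<notin> B \<longrightarrow> c b = 0)}
      \<inter> {c. (\<Sum>b\<in>B. \<bar>c b\<bar>) = 1}"
  have "closed {c::'v \<Rightarrow> real. (\<Sum>b\<in>B. \<bar>c b\<bar>) = 1}"
    by (intro closed_Collect_eq continuous_intros continuous_on_product_coordinates)
  then have S: "compact S"
    unfolding S_def by (intro compact_Int_closed compact_coefficient_box)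
  have "\<exists>m>0. \<forall>c\<in>S. m \<le> norm (\<Sum>b\<in>B. c b *\<^sub>R b)"
  proof (cases "S = {}")
    case False
    have "continuous_on S (\<lambda>c::'v \<Rightarrow> real. norm (\<Sum>b\<in>B. c b *\<^sub>R b))"
      by (intro continuous_on_norm continuous_on_subset[OF combination_continuous]) auto
    then obtain c where c: "c \<in> S" "\<forall>c'\<in>S. norm (\<Sum>b\<in>B. c b *\<^sub>R b) \<le> norm (\<Sum>b\<in>B. c' b *\<^sub>R b)"
      using continuous_attains_inf[OF S False] by blast
    have "(\<Sum>b\<in>B. c b *\<^sub>R b) \<noteq> 0"
    proof
      assume "(\<Sum>b\<in>B. c b *\<^sub>R b) = 0"
      from coord_unique[OF this] have "(\<Sum>b\<in>B. \<bar>c b\<bar>) = 0"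
        by (intro sum.neutral) simp
      with c(1) show False
        by (simp add: S_def)
    qed
    with c(2) show ?thesis
      by (metis zero_less_norm_iff)
  qed (auto intro: exI[of _ 1])
  then obtain m where m: "m > 0" "\<And>c. c \<in> S \<Longrightarrow> m \<le> norm (\<Sum>b\<in>B. c b *\<^sub>R b)"
    by auto
  have "\<bar>coord b x\<bar> \<le> 1 / m * norm x" if "b \<in> B" for x b
  proof -
    define s where "s = (\<Sum>b\<in>B. \<bar>coord b x\<bar>)"
    have le: "\<bar>coord b x\<bar> \<le> s" if "b \<in> B" for b
      unfolding s_def using finite_B that by (intro member_le_sum) auto
    show ?thesis
    proof (cases "s = 0")
      case False
      then have s: "s > 0"
        by (simp add: s_def order_less_le sum_nonneg)
      define c where "c b = (if b \<in> B then coord b x / s else 0)" for b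
      have "(\<Sum>b\<in>B. \<bar>c b\<bar>) = s / s"
        unfolding s_def sum_divide_distrib
        using s by (intro sum.cong) (simp_all add: c_def s_def)
      then have "c \<in> S"
        using le s by (auto simp: S_def c_def)
      moreover have "(\<Sum>b\<in>B. c b *\<^sub>R b) = (1/s) *\<^sub>R (\<Sum>b\<in>B. coord b x *\<^sub>R b)"
        by (simp add: scaleR_sum_right c_def)
      ultimately have "m \<le> norm x / s"
        using m(2)[of c] s by (simp add: sum_coord)
      then have "s \<le> 1 / m * norm x"
        using s m(1) by (simp add: field_simps)
      with le[OF that] show ?thesis
        by linarith
    qed (use le[OF that] m(1) in auto)
  qed
  then show ?thesis
    using m(1) by (intro exI[of _ "1/m"]) auto
qed

lemma bounded_linear_coord: 
  assumes "b \<in> B"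
  shows "bounded_linear (coord b)"
proof -
  obtain C where "\<forall>x. \<forall>b\<in>B. \<bar>coord b x\<bar> \<le> C * norm x"
    using coord_bounded by blast
  with assms show ?thesis
    by (intro bounded_linear.intro bounded_linear_axioms.intro linear_coord exI[of _ C])
       (auto simp: mult.commute)
qed

lemma linear_imp_bounded_linear:
  fixes f :: "'v \<Rightarrow> 'w::real_normed_vector"
  assumes "linear f"
  shows "bounded_linear f"
proof -
  have "f x = (\<Sum>b\<in>B. coord b x *\<^sub>R f b)" for x
  proof -
    have "f (\<Sum>b\<in>B. coord b x *\<^sub>R b) = (\<Sum>b\<in>B. coord b x *\<^sub>R f b)"
      by (simp add: linear_sum[OF assms] linear_scale[OF assms])
    then show ?thesis
      by (simp add: sum_coord)
  qed
  then have eq: "f = (\<lambda>x. \<Sum>b\<in>B. coord b x *\<^sub>R f b)"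
    by (rule ext)
  have "bounded_linear (\<lambda>x. \<Sum>b\<in>B. coord b x *\<^sub>R f b)"
    by (intro bounded_linear_sum bounded_linear_scaleR_const bounded_linear_coord)
  then show ?thesis
    by (subst eq)
qed

lemma compact_cball: "compact (cball (0::'v) r)"
proof -
  obtain C where C: "C > 0" "\<And>x b. b \<in> B \<Longrightarrow> \<bar>coord b x\<bar> \<le> C * norm x"
    using coord_bounded by blast
  let ?K = "{c::'v \<Rightarrow> real. (\<forall>b\<in>B. \<bar>c b\<bar> \<le> C * r) \<and> (\<forall>b. b \<notin> B \<longrightarrow> c b = 0)}"
  have "compact ((\<lambda>c. \<Sum>b\<in>B. c b *\<^sub>R b) ` ?K)"
    by (intro compact_continuous_image compact_coefficient_box
          continuous_on_subset[OF combination_continuous]) auto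
  moreover have "cball 0 r \<subseteq> (\<lambda>c. \<Sum>b\<in>B. c b *\<^sub>R b) ` ?K"
  proof
    fix x :: 'v
    assume "x \<in> cball 0 r"
    then have "norm x \<le> r"
      by simp
    then have "\<bar>coord b x\<bar> \<le> C * r" if "b \<in> B" for b
      using C(2)[OF that, of x] C(1) by (meson mult_left_mono less_imp_le order_trans)
    then show "x \<in> (\<lambda>c. \<Sum>b\<in>B. c b *\<^sub>R b) ` ?K"
      using sum_coord[of x]
      by (intro image_eqI[where x = "\<lambda>b. if b \<in> B then coord b x else 0"]) simp_all
  qed
  ultimately have "compact ((\<lambda>c. \<Sum>b\<in>B. c b *\<^sub>R b) ` ?K \<inter> cball 0 r)"
    and "(\<lambda>c. \<Sum>b\<in>B. c b *\<^sub>R b) ` ?K \<inter> cball 0 r = cball 0 r"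
    using compact_Int_closed closed_cball by (blast, simp only: inf.absorb2)
  then show ?thesis
    by simp
qed

lemma bounded_imp_convergent_subsequence:
  fixes x :: "nat \<Rightarrow> 'v"
  assumes "\<And>n. norm (x n) \<le> r"
  obtains l \<sigma> where "strict_mono (\<sigma>::nat \<Rightarrow> nat)" "(x \<circ> \<sigma>) \<longlonglongrightarrow> l"
proof -
  have "seq_compact (cball (0::'v) r)"
    using compact_cball by (simp add: compact_eq_seq_compact_metric)
  moreover have "\<forall>n. x n \<in> cball 0 r"
    using assms by simp
  ultimately show thesis
    using that unfolding seq_compact_def by blast
qed

lemma injective_imp_surjective:
  fixes f :: "'v \<Rightarrow> 'v"
  assumes "linear f" "inj f"
  shows "surj f"
proof -
  interpret V: finite_dimensional_vector_space "scaleR :: real \<Rightarrow> 'v \<Rightarrow> 'v" B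
    by unfold_locales
      (use finite_B independent_B span_B in
        \<open>simp_all add: scaleR_add_right scaleR_add_left dependent_raw_def span_raw_def\<close>)
  show ?thesis
    using V.linear_inj_imp_surj[of f] assms by (simp add: linear_def)
qed

text \<open>
  The operators $x \mapsto x_b b'$, one for each pair of basis vectors, span all operators;
  so compactness and power series are available for operators as well.
\<close>
lemma operator_basis_exists: "\<exists>C :: ('v \<Rightarrow>\<^sub>L 'v) set. finite_basis C"
proof -
  define E where "E b b' = Blinfun (\<lambda>x. coord b x *\<^sub>R b')" for b b' :: 'v
  have E: "blinfun_apply (E b b') x = coord b x *\<^sub>R b'" if "b \<in> B" for b b' x :: 'v
    unfolding E_def using that
    by (simp add: bounded_linear_Blinfun_apply bounded_linear_scaleR_const bounded_linear_coord)
  define G where "G = (\<lambda>(b, b'). E b b') ` (B \<times> B)"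
  have "W \<in> span G" for W
  proof -
    have "W = (\<Sum>b\<in>B. \<Sum>b'\<in>B. coord b' (W b) *\<^sub>R E b b')"
    proof (rule blinfun_eqI)
      fix x
      have "blinfun_apply (\<Sum>b\<in>B. \<Sum>b'\<in>B. coord b' (W b) *\<^sub>R E b b') x
          = (\<Sum>b\<in>B. \<Sum>b'\<in>B. coord b' (W b) *\<^sub>R (coord b x *\<^sub>R b'))"
        by (simp add: blinfun.sum_left blinfun.scaleR_left E)
      also have "\<dots> = (\<Sum>b\<in>B. coord b x *\<^sub>R W b)"
      proof (rule sum.cong)
        fix b
        have "(\<Sum>b'\<in>B. coord b' (W b) *\<^sub>R (coord b x *\<^sub>R b'))
            = coord b x *\<^sub>R (\<Sum>b'\<in>B. coord b' (W b) *\<^sub>R b')"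
          by (simp add: scaleR_sum_right mult.commute)
        then show "(\<Sum>b'\<in>B. coord b' (W b) *\<^sub>R (coord b x *\<^sub>R b')) = coord b x *\<^sub>R W b"
          by (simp add: sum_coord)
      qed simp
      also have "\<dots> = W (\<Sum>b\<in>B. coord b x *\<^sub>R b)"
        by (simp add: blinfun.sum_right blinfun.scaleR_right)
      finally show "W x = blinfun_apply (\<Sum>b\<in>B. \<Sum>b'\<in>B. coord b' (W b) *\<^sub>R E b b') x"
        by (simp add: sum_coord)
    qed
    moreover have "(\<Sum>b\<in>B. \<Sum>b'\<in>B. coord b' (W b) *\<^sub>R E b b') \<in> span G"
      by (intro real_vector.span_sum real_vector.span_scale real_vector.span_base)
         (auto simp: G_def)
    ultimately show ?thesis
      by simp
  qed
  then have G: "span G = UNIV" "finite G"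
    using finite_B by (auto simp: G_def)
  obtain C where C: "C \<subseteq> G" "independent C" "G \<subseteq> span C"
    using real_vector.maximal_independent_subset[of G] by blast
  have "span G \<subseteq> span C"
    using C(3) by (metis real_vector.span_mono real_vector.span_span)
  with G C have "finite_basis C"
    by (intro finite_basis.intro) (auto intro: finite_subset)
  then show ?thesis ..
qed

text \<open>
  Differentiating $\sum_n t^n a_n / n!$ shifts the sequence $a$ by one, so that such a sum is
  smooth with derivatives of the same shape.  In each coordinate this is termwise
  differentiation of an entire real power series.
\<close>
lemma exponential_series:
  fixes a :: "nat \<Rightarrow> 'v" and C r :: real
  assumes a: "\<And>n. norm (a n) \<le> C * r ^ n"
  shows "summable (\<lambda>n. (t ^ n / fact n) *\<^sub>R a n)"
    and "((\<lambda>t. \<Sum>n. (t ^ n / fact n) *\<^sub>R a n) has_vector_derivative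
          (\<Sum>n. (t ^ n / fact n) *\<^sub>R a (Suc n))) (at t)"
proof -
  obtain M where M: "M > 0" "\<And>x b. b \<in> B \<Longrightarrow> \<bar>coord b x\<bar> \<le> M * norm x"
    using coord_bounded by blast
  have summ: "summable (\<lambda>n. coord b (a (n + k)) / fact n * t ^ n)" if "b \<in> B" for b k t
  proof (rule summable_comparison_test')
    show "summable (\<lambda>n. M * C * r ^ k * (inverse (fact n) * (r * \<bar>t\<bar>) ^ n))"
      by (intro summable_mult summable_exp)
    fix n :: nat
    have "\<bar>coord b (a (n + k))\<bar> \<le> M * C * r ^ (n + k)"
      using order_trans[OF M(2)[OF that] mult_left_mono[OF a[of "n+k"], of M]] M(1)
      by (simp add: mult.assoc)
    then have "\<bar>coord b (a (n + k))\<bar> * (\<bar>t\<bar> ^ n / fact n) \<le> M * C * r ^ (n + k) * (\<bar>t\<bar> ^ n / fact n)"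
      by (intro mult_right_mono) auto
    then show "norm (coord b (a (n + k)) / fact n * t ^ n)
        \<le> M * C * r ^ k * (inverse (fact n) * (r * \<bar>t\<bar>) ^ n)"
      by (simp add: abs_mult power_abs power_mult_distrib power_add field_simps)
  qed
  have sums: "(\<lambda>n. (t ^ n / fact n) *\<^sub>R a (n + k)) sums
      (\<Sum>b\<in>B. (\<Sum>n. coord b (a (n + k)) / fact n * t ^ n) *\<^sub>R b)" for k t
  proof -
    have "(\<lambda>n. \<Sum>b\<in>B. (coord b (a (n + k)) / fact n * t ^ n) *\<^sub>R b) sums
      (\<Sum>b\<in>B. (\<Sum>n. coord b (a (n + k)) / fact n * t ^ n) *\<^sub>R b)"
      by (intro sums_sum bounded_linear.sums[OF bounded_linear_scaleR_left] summable_sums summ)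
    moreover have "(\<Sum>b\<in>B. (coord b (a (n + k)) / fact n * t ^ n) *\<^sub>R b)
        = (t ^ n / fact n) *\<^sub>R a (n + k)" for n
    proof -
      have "(\<Sum>b\<in>B. (coord b (a (n + k)) / fact n * t ^ n) *\<^sub>R b)
          = (t ^ n / fact n) *\<^sub>R (\<Sum>b\<in>B. coord b (a (n + k)) *\<^sub>R b)"
        by (simp add: scaleR_sum_right mult.commute)
      then show ?thesis
        by (simp add: sum_coord)
    qed
    ultimately show ?thesis
      by simp
  qed
  show "summable (\<lambda>n. (t ^ n / fact n) *\<^sub>R a n)"
    using sums[of t 0] by (simp add: sums_iff)
  have eq0: "(\<lambda>t. \<Sum>n. (t ^ n / fact n) *\<^sub>R a n)
      = (\<lambda>t. \<Sum>b\<in>B. (\<Sum>n. coord b (a n) / fact n * t ^ n) *\<^sub>R b)"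
    using sums[of _ 0] by (auto simp: sums_iff)
  have eq1: "(\<Sum>n. (t ^ n / fact n) *\<^sub>R a (Suc n))
      = (\<Sum>b\<in>B. (\<Sum>n. coord b (a (Suc n)) / fact n * t ^ n) *\<^sub>R b)"
    using sums[of t 1] by (auto simp: sums_iff)
  have "((\<lambda>t. \<Sum>n. coord b (a n) / fact n * t ^ n) has_field_derivative
      (\<Sum>n. coord b (a (Suc n)) / fact n * t ^ n)) (at t)" if "b \<in> B" for b
  proof -
    have "diffs (\<lambda>n. coord b (a n) / fact n) = (\<lambda>n. coord b (a (Suc n)) / fact n)"
      by (simp add: diffs_def fun_eq_iff divide_simps del: of_nat_Suc)
    with termdiffs_strong_converges_everywhere[of "\<lambda>n. coord b (a n) / fact n" t] summ[OF that, of 0]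
    show ?thesis
      by simp
  qed
  then have "((\<lambda>t. \<Sum>b\<in>B. (\<Sum>n. coord b (a n) / fact n * t ^ n) *\<^sub>R b) has_vector_derivative
      (\<Sum>b\<in>B. (\<Sum>n. coord b (a (Suc n)) / fact n * t ^ n) *\<^sub>R b)) (at t)"
    by (intro has_vector_derivative_sum
          bounded_linear.has_vector_derivative[OF bounded_linear_scaleR_left])
       (simp add: has_real_derivative_iff_has_vector_derivative)
  then show "((\<lambda>t. \<Sum>n. (t ^ n / fact n) *\<^sub>R a n) has_vector_derivative
          (\<Sum>n. (t ^ n / fact n) *\<^sub>R a (Suc n))) (at t)"
    by (simp add: eq0 eq1)
qed

end

section \<open>Conservative operators\<close>

text \<open>
  These are the operators $W$ with $\|y + s W y\| = \|y\| + o(s)$ for every $y$, that is, the Lie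
  algebra of the group of linear isometries.  It is enough to ask for an upper bound for both signs at
  a single $\delta$ for each $\varepsilon$: convexity of the norm carries it to all smaller $s$ and turns
  it into a two-sided estimate.  The weak form makes it easy to recognise limits of difference
  quotients as conservative.
\<close>
definition conservative :: "('a::real_normed_vector \<Rightarrow>\<^sub>L 'a) set"
  where "conservative = {W :: 'a \<Rightarrow>\<^sub>L 'a. \<forall>y. \<forall>\<epsilon>>0. \<exists>\<delta>>0.
    norm (y + \<delta> *\<^sub>R W y) \<le> norm y + \<epsilon> * \<delta> \<and> norm (y - \<delta> *\<^sub>R W y) \<le> norm y + \<epsilon> * \<delta>}"

text \<open>
  For $|s| \le \delta$ the point $y + s W y$ is a convex combination of $y$ and
  $y \pm \delta W y$, which gives the upper bound.  The lower bound follows from the upper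
  bound for $-s$, since $y$ is the midpoint of $y + s W y$ and $y - s W y$.
\<close>
lemma conservative_norm_estimate:
  assumes "W \<in> conservative" "\<epsilon> > 0"
  shows "\<exists>\<delta>>0. \<forall>s. \<bar>s\<bar> \<le> \<delta> \<longrightarrow> \<bar>norm (y + s *\<^sub>R W y) - norm y\<bar> \<le> \<epsilon> * \<bar>s\<bar>"
proof -
  obtain \<delta> where \<delta>: "\<delta> > 0" "norm (y + \<delta> *\<^sub>R W y) \<le> norm y + \<epsilon> * \<delta>"
      "norm (y - \<delta> *\<^sub>R W y) \<le> norm y + \<epsilon> * \<delta>"
    using assms unfolding conservative_def by blast
  have upper: "norm (y + s *\<^sub>R W y) \<le> norm y + \<epsilon> * \<bar>s\<bar>" if "\<bar>s\<bar> \<le> \<delta>" for s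
  proof -
    \<comment> \<open>The weight of $z$, the one of the points $y \pm \delta W y$ on the side of $s$.\<close>
    define r where "r = \<bar>s\<bar> / \<delta>"
    define z where "z = (if s \<ge> 0 then y + \<delta> *\<^sub>R W y else y - \<delta> *\<^sub>R W y)"
    have r: "0 \<le> r" "r \<le> 1" and r\<delta>: "r * \<delta> = \<bar>s\<bar>"
      using that \<delta>(1) by (auto simp: r_def)
    have "y + s *\<^sub>R W y = (1 - r) *\<^sub>R y + r *\<^sub>R z"
      using r\<delta> by (auto simp: z_def algebra_simps)
    then have "norm (y + s *\<^sub>R W y) \<le> (1 - r) * norm y + r * norm z"
      using norm_triangle_ineq[of "(1 - r) *\<^sub>R y" "r *\<^sub>R z"] r by simp
    also have "\<dots> \<le> (1 - r) * norm y + r * (norm y + \<epsilon> * \<delta>)"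
      using \<delta> r(1) by (intro add_left_mono mult_left_mono) (auto simp: z_def)
    also have "\<dots> = norm y + \<epsilon> * (r * \<delta>)"
      by (simp add: algebra_simps)
    finally show ?thesis
      by (simp add: r\<delta>)
  qed
  have "\<bar>norm (y + s *\<^sub>R W y) - norm y\<bar> \<le> \<epsilon> * \<bar>s\<bar>" if "\<bar>s\<bar> \<le> \<delta>" for s
  proof -
    have "2 * norm y = norm ((y + s *\<^sub>R W y) + (y + (- s) *\<^sub>R W y))"
      by (simp flip: scaleR_2)
    also have "\<dots> \<le> norm (y + s *\<^sub>R W y) + norm (y + (- s) *\<^sub>R W y)"
      by (rule norm_triangle_ineq)
    finally show ?thesis
      using upper[of s] upper[of "- s"] that by simp
  qed
  with \<delta>(1) show ?thesis
    by blast
qed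

text \<open>
  For sums, $y + s (V + W) y$ is the midpoint of $y + 2 s V y$ and $y + 2 s W y$.
\<close>
lemma subspace_conservative: "subspace conservative"
proof (rule subspaceI)
  show "0 \<in> (conservative :: ('a \<Rightarrow>\<^sub>L 'a) set)"
    by (auto simp: conservative_def intro!: exI[of _ 1])
next
  fix V W :: "'a \<Rightarrow>\<^sub>L 'a"
  assume V: "V \<in> conservative" and W: "W \<in> conservative"
  show "V + W \<in> conservative"
    unfolding conservative_def
  proof safe
    fix y :: 'a and \<epsilon> :: real
    assume "\<epsilon> > 0"
    obtain \<delta>1 where \<delta>1: "\<delta>1 > 0"
      "\<And>s. \<bar>s\<bar> \<le> \<delta>1 \<Longrightarrow> \<bar>norm (y + s *\<^sub>R V y) - norm y\<bar> \<le> \<epsilon> / 2 * \<bar>s\<bar>"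
      using conservative_norm_estimate[OF V, of "\<epsilon> / 2" y] \<open>\<epsilon> > 0\<close> by auto
    obtain \<delta>2 where \<delta>2: "\<delta>2 > 0"
      "\<And>s. \<bar>s\<bar> \<le> \<delta>2 \<Longrightarrow> \<bar>norm (y + s *\<^sub>R W y) - norm y\<bar> \<le> \<epsilon> / 2 * \<bar>s\<bar>"
      using conservative_norm_estimate[OF W, of "\<epsilon> / 2" y] \<open>\<epsilon> > 0\<close> by auto
    define \<delta> where "\<delta> = min \<delta>1 \<delta>2 / 2"
    have \<delta>: "\<delta> > 0" "2 * \<delta> \<le> \<delta>1" "2 * \<delta> \<le> \<delta>2"
      using \<delta>1(1) \<delta>2(1) by (auto simp: \<delta>_def)
    have bound: "norm (y + s *\<^sub>R (V + W) y) \<le> norm y + \<epsilon> * \<bar>s\<bar>" if s: "\<bar>s\<bar> = \<delta>" for s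
    proof -
      have "y + s *\<^sub>R (V + W) y
          = (1/2) *\<^sub>R ((y + (2 * s) *\<^sub>R V y) + (y + (2 * s) *\<^sub>R W y))"
        by (simp add: blinfun.add_left scaleR_add_right flip: scaleR_2)
      then have "norm (y + s *\<^sub>R (V + W) y)
          \<le> (1/2) * (norm (y + (2 * s) *\<^sub>R V y) + norm (y + (2 * s) *\<^sub>R W y))"
        using norm_triangle_ineq[of "y + (2 * s) *\<^sub>R V y" "y + (2 * s) *\<^sub>R W y"] by simp
      then show ?thesis
        using \<delta>1(2)[of "2 * s"] \<delta>2(2)[of "2 * s"] s \<delta> by (simp add: abs_mult)
    qed
    show "\<exists>\<delta>>0. norm (y + \<delta> *\<^sub>R (V + W) y) \<le> norm y + \<epsilon> * \<delta> \<and>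
        norm (y - \<delta> *\<^sub>R (V + W) y) \<le> norm y + \<epsilon> * \<delta>"
      using bound[of \<delta>] bound[of "- \<delta>"] \<delta>(1) by (intro exI[of _ \<delta>]) simp
  qed
next
  fix c :: real and W :: "'a \<Rightarrow>\<^sub>L 'a"
  assume W: "W \<in> conservative"
  show "c *\<^sub>R W \<in> conservative"
    unfolding conservative_def
  proof safe
    fix y :: 'a and \<epsilon> :: real
    assume "\<epsilon> > 0"
    define k where "k = \<bar>c\<bar> + 1"
    have k: "k > 0" "\<bar>c\<bar> \<le> k"
      by (auto simp: k_def)
    obtain \<delta> where \<delta>: "\<delta> > 0"
      "\<And>s. \<bar>s\<bar> \<le> \<delta> \<Longrightarrow> \<bar>norm (y + s *\<^sub>R W y) - norm y\<bar> \<le> \<epsilon> / k * \<bar>s\<bar>"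
      using conservative_norm_estimate[OF W, of "\<epsilon> / k" y] \<open>\<epsilon> > 0\<close> k(1) by auto
    have bound: "norm (y + s *\<^sub>R (c *\<^sub>R W) y) \<le> norm y + \<epsilon> * \<bar>s\<bar>" if s: "\<bar>s\<bar> = \<delta> / k" for s
    proof -
      have "\<bar>s * c\<bar> \<le> \<delta> / k * k"
        unfolding abs_mult s using k \<delta>(1) by (intro mult_left_mono) auto
      then have "norm (y + (s * c) *\<^sub>R W y) \<le> norm y + \<epsilon> / k * \<bar>s * c\<bar>"
        using \<delta>(2)[of "s * c"] k(1) by simp
      also have "\<epsilon> / k * \<bar>s * c\<bar> = \<epsilon> * \<bar>s\<bar> * (\<bar>c\<bar> / k)"
        by (simp add: abs_mult)
      also have "\<dots> \<le> \<epsilon> * \<bar>s\<bar>"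
        using k \<open>\<epsilon> > 0\<close> by (intro mult_right_le_one_le) auto
      finally show ?thesis
        by (simp add: blinfun.scaleR_left)
    qed
    show "\<exists>\<delta>>0. norm (y + \<delta> *\<^sub>R (c *\<^sub>R W) y) \<le> norm y + \<epsilon> * \<delta> \<and>
        norm (y - \<delta> *\<^sub>R (c *\<^sub>R W) y) \<le> norm y + \<epsilon> * \<delta>"
      using bound[of "\<delta> / k"] bound[of "- (\<delta> / k)"] \<delta>(1) k(1)
      by (intro exI[of _ "\<delta> / k"]) simp
  qed
qed

lemma closed_conservative: "closed (conservative :: ('a::real_normed_vector \<Rightarrow>\<^sub>L 'a) set)"
  unfolding closed_sequential_limits
proof (intro allI impI)
  fix X and W :: "'a \<Rightarrow>\<^sub>L 'a"
  assume "(\<forall>n. X n \<in> conservative) \<and> X \<longlonglongrightarrow> W"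
  then have X: "\<And>n. X n \<in> conservative" and lim: "X \<longlonglongrightarrow> W"
    by auto
  show "W \<in> conservative"
    unfolding conservative_def
  proof safe
    fix y :: 'a and \<epsilon> :: real
    assume "\<epsilon> > 0"
    have "(\<lambda>n. norm ((W - X n) y)) \<longlonglongrightarrow> norm ((W - W) y)"
      by (intro tendsto_intros lim)
    then have "\<forall>\<^sub>F n in sequentially. norm ((W - X n) y) < \<epsilon> / 2"
      using \<open>\<epsilon> > 0\<close> by (intro order_tendstoD) auto
    then obtain n where n: "norm ((W - X n) y) < \<epsilon> / 2"
      by (auto simp: eventually_sequentially)
    obtain \<delta> where \<delta>: "\<delta> > 0"
      "\<And>s. \<bar>s\<bar> \<le> \<delta> \<Longrightarrow> \<bar>norm (y + s *\<^sub>R X n y) - norm y\<bar> \<le> \<epsilon> / 2 * \<bar>s\<bar>"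
      using conservative_norm_estimate[OF X, of "\<epsilon> / 2" y] \<open>\<epsilon> > 0\<close> by auto
    have bound: "norm (y + s *\<^sub>R W y) \<le> norm y + \<epsilon> * \<bar>s\<bar>" if s: "\<bar>s\<bar> = \<delta>" for s
    proof -
      have "y + s *\<^sub>R W y = (y + s *\<^sub>R X n y) + s *\<^sub>R (W - X n) y"
        by (simp add: blinfun.diff_left algebra_simps)
      then have "norm (y + s *\<^sub>R W y) \<le> norm (y + s *\<^sub>R X n y) + \<bar>s\<bar> * norm ((W - X n) y)"
        using norm_triangle_ineq[of "y + s *\<^sub>R X n y" "s *\<^sub>R (W - X n) y"]
        by (simp only: norm_scaleR)
      moreover have "\<bar>s\<bar> * norm ((W - X n) y) \<le> \<epsilon> / 2 * \<bar>s\<bar>"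
        using n by (subst mult.commute, intro mult_right_mono) auto
      moreover have "\<bar>norm (y + s *\<^sub>R X n y) - norm y\<bar> \<le> \<epsilon> / 2 * \<bar>s\<bar>"
        using \<delta>(2)[of s] s by simp
      ultimately show ?thesis
        by linarith
    qed
    show "\<exists>\<delta>>0. norm (y + \<delta> *\<^sub>R W y) \<le> norm y + \<epsilon> * \<delta> \<and>
        norm (y - \<delta> *\<^sub>R W y) \<le> norm y + \<epsilon> * \<delta>"
      using bound[of \<delta>] bound[of "- \<delta>"] \<delta>(1) by (intro exI[of _ \<delta>]) simp
  qed
qed

definition linear_isometries :: "('a::real_normed_vector \<Rightarrow>\<^sub>L 'a) set"
  where "linear_isometries = {L :: 'a \<Rightarrow>\<^sub>L 'a. \<forall>x. norm (L x) = norm x}"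

text \<open>
  With $V_n = (M_n - 1) / r_n$ one has $y + r_n V y \approx y + r_n V_n y = M_n y$, a vector of
  norm $\|y\|$, with an error that is $o(1) \cdot r_n$.  For the other sign the inverse of $M_n$ is
  avoided by applying $M_n$ itself: $M_n (y - r_n V y) \approx y$ with the same kind of error.
  The step $\delta$ is $r_n$ for a single large $n$.
\<close>
lemma limit_of_isometry_quotients_conservative:
  assumes M: "\<And>n. M n \<in> linear_isometries" "M \<longlonglongrightarrow> id_blinfun"
    and r: "\<And>n. r n > 0"
    and lim: "(\<lambda>n. (1 / r n) *\<^sub>R (M n - id_blinfun)) \<longlonglongrightarrow> V"
  shows "V \<in> conservative"
  unfolding conservative_def
proof safe
  fix y :: 'a and \<epsilon> :: real
  assume \<epsilon>: "\<epsilon> > 0"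
  define Q where "Q n = (1 / r n) *\<^sub>R (M n - id_blinfun)" for n
  have "(\<lambda>n. norm ((Q n - V) y) + norm ((id_blinfun - M n) (V y)))
      \<longlonglongrightarrow> norm ((V - V) y) + norm ((id_blinfun - id_blinfun) (V y))"
    using lim unfolding Q_def[symmetric] by (intro tendsto_intros M(2))
  then have "\<forall>\<^sub>F n in sequentially. norm ((Q n - V) y) + norm ((id_blinfun - M n) (V y)) < \<epsilon>"
    using \<epsilon> by (intro order_tendstoD) auto
  then obtain n where n: "norm ((Q n - V) y) + norm ((id_blinfun - M n) (V y)) < \<epsilon>"
    by (auto simp: eventually_sequentially)
  have isoM: "norm (M n z) = norm z" for z
    using M(1)[of n] by (simp add: linear_isometries_def)
  have My: "M n y = y + r n *\<^sub>R Q n y"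
    using r[of n] by (simp add: Q_def blinfun.scaleR_left blinfun.diff_left)
  have "y + r n *\<^sub>R V y = M n y - r n *\<^sub>R (Q n - V) y"
    by (simp add: My blinfun.diff_left algebra_simps)
  then have "norm (y + r n *\<^sub>R V y) \<le> norm y + r n * norm ((Q n - V) y)"
    using norm_triangle_ineq4[of "M n y" "r n *\<^sub>R (Q n - V) y"] r[of n] M(1)[of n]
    by (simp add: linear_isometries_def)
  also have "\<dots> \<le> norm y + r n * \<epsilon>"
    using n r[of n] norm_ge_zero[of "(id_blinfun - M n) (V y)"]
    by (intro add_left_mono mult_left_mono) linarith+
  finally have plus: "norm (y + r n *\<^sub>R V y) \<le> norm y + \<epsilon> * r n"
    by (simp add: mult.commute)
  have "M n (y - r n *\<^sub>R V y)
      = y + r n *\<^sub>R ((Q n - V) y + (id_blinfun - M n) (V y))"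
    by (simp add: My blinfun.diff_left blinfun.diff_right blinfun.scaleR_right algebra_simps)
  then have "norm (y - r n *\<^sub>R V y)
      = norm (y + r n *\<^sub>R ((Q n - V) y + (id_blinfun - M n) (V y)))"
    using isoM by metis
  also have "\<dots> \<le> norm y + r n * norm ((Q n - V) y + (id_blinfun - M n) (V y))"
    using norm_triangle_ineq[of y "r n *\<^sub>R ((Q n - V) y + (id_blinfun - M n) (V y))"] r[of n]
    by simp
  also have "\<dots> \<le> norm y + r n * \<epsilon>"
    using n r[of n] norm_triangle_ineq[of "(Q n - V) y" "(id_blinfun - M n) (V y)"]
    by (intro add_left_mono mult_left_mono) linarith+
  finally have "norm (y - r n *\<^sub>R V y) \<le> norm y + \<epsilon> * r n"
    by (simp add: mult.commute)
  with plus r[of n] show "\<exists>\<delta>>0. norm (y + \<delta> *\<^sub>R V y) \<le> norm y + \<epsilon> * \<delta> \<and>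
      norm (y - \<delta> *\<^sub>R V y) \<le> norm y + \<epsilon> * \<delta>"
    by blast
qed

text \<open>
  Although the norm need not be differentiable, $t \mapsto \|c(t)\|$ is, with derivative zero:
  to first order $c(t + s)$ equals $c(t) + s W c(t)$, whose norm is $\|c(t)\| + o(s)$.
\<close>
lemma conservative_flow_preserves_norm:
  fixes c :: "real \<Rightarrow> 'a::real_normed_vector"
  assumes W: "W \<in> conservative"
    and c: "\<And>t. (c has_vector_derivative W (c t)) (at t)"
  shows "norm (c t) = norm (c 0)"
proof -
  have "((\<lambda>t. norm (c t)) has_real_derivative 0) (at t)" for t
    unfolding has_field_derivative_def has_derivative_at_alt
  proof safe
    fix \<epsilon> :: real
    assume \<epsilon>: "\<epsilon> > 0"
    obtain \<delta>1 where \<delta>1: "\<delta>1 > 0"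
      "\<And>s. \<bar>s\<bar> \<le> \<delta>1 \<Longrightarrow> \<bar>norm (c t + s *\<^sub>R W (c t)) - norm (c t)\<bar> \<le> \<epsilon> / 2 * \<bar>s\<bar>"
      using conservative_norm_estimate[OF W, of "\<epsilon> / 2" "c t"] \<epsilon> by auto
    obtain \<delta>2 where \<delta>2: "\<delta>2 > 0"
      "\<And>u. \<bar>u - t\<bar> < \<delta>2 \<Longrightarrow> norm (c u - c t - (u - t) *\<^sub>R W (c t)) \<le> \<epsilon> / 2 * \<bar>u - t\<bar>"
      using c[of t, unfolded has_vector_derivative_def has_derivative_at_alt, THEN conjunct2,
          rule_format, of "\<epsilon> / 2"] \<epsilon> by auto
    show "\<exists>d>0. \<forall>u. norm (u - t) < d \<longrightarrow>
        norm (norm (c u) - norm (c t) - 0 * (u - t)) \<le> \<epsilon> * norm (u - t)"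
    proof (intro exI[of _ "min \<delta>1 \<delta>2"] conjI allI impI)
      fix u
      assume u: "norm (u - t) < min \<delta>1 \<delta>2"
      have "\<bar>norm (c u) - norm (c t + (u - t) *\<^sub>R W (c t))\<bar>
          \<le> norm (c u - (c t + (u - t) *\<^sub>R W (c t)))"
        by (rule norm_triangle_ineq3)
      also have "\<dots> \<le> \<epsilon> / 2 * \<bar>u - t\<bar>"
        using \<delta>2(2)[of u] u by (simp add: diff_diff_eq)
      finally have "\<bar>norm (c u) - norm (c t + (u - t) *\<^sub>R W (c t))\<bar> \<le> \<epsilon> / 2 * \<bar>u - t\<bar>" .
      moreover have "\<bar>norm (c t + (u - t) *\<^sub>R W (c t)) - norm (c t)\<bar> \<le> \<epsilon> / 2 * \<bar>u - t\<bar>"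
        using \<delta>1(2)[of "u - t"] u by simp
      ultimately have "\<bar>norm (c u) - norm (c t)\<bar> \<le> \<epsilon> / 2 * \<bar>u - t\<bar> + \<epsilon> / 2 * \<bar>u - t\<bar>"
        by linarith
      then show "norm (norm (c u) - norm (c t) - 0 * (u - t)) \<le> \<epsilon> * norm (u - t)"
        by simp
    qed (use \<delta>1 \<delta>2 in auto)
  qed (rule bounded_linear_mult_right)
  then show ?thesis
    by (rule DERIV_isconst_all[rule_format])
qed

section \<open>Tangent spaces of the isometry group\<close>

lemma smooth_curve_bounded_linear:
  assumes "bounded_linear f" "smooth_curve e c"
  shows "smooth_curve e (\<lambda>t. f (c t))"
proof -
  obtain D where "D 0 = c"
    "\<forall>n. \<forall>t\<in>{-e<..<e}. (D n has_vector_derivative D (Suc n) t) (at t)"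
    using assms(2) unfolding smooth_curve_def by blast
  then show ?thesis
    unfolding smooth_curve_def
    by (intro exI[of _ "\<lambda>n t. f (D n t)"])
       (auto intro!: bounded_linear.has_vector_derivative[OF assms(1)])
qed

lemma smooth_curve_add:
  assumes "smooth_curve e c" "smooth_curve e c'"
  shows "smooth_curve e (\<lambda>t. c t + c' t)"
proof -
  obtain D D' where "D 0 = c" "D' 0 = c'"
    "\<forall>n. \<forall>t\<in>{-e<..<e}. (D n has_vector_derivative D (Suc n) t) (at t)"
    "\<forall>n. \<forall>t\<in>{-e<..<e}. (D' n has_vector_derivative D' (Suc n) t) (at t)"
    using assms unfolding smooth_curve_def by blast
  then show ?thesis
    unfolding smooth_curve_def
    by (intro exI[of _ "\<lambda>n t. D n t + D' n t"]) (auto intro!: has_vector_derivative_add)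
qed

text \<open>
  Straight lines supply the translational part of curves of isometries.
\<close>
lemma smooth_curve_line: "smooth_curve e (\<lambda>t. b + t *\<^sub>R w)"
proof -
  define D where "D n t = (if n = 0 then b + t *\<^sub>R w else if n = 1 then w else 0)" for n :: nat and t :: real
  have "(D n has_vector_derivative D (Suc n) t) (at t)" for n t
    unfolding D_def
    by (cases "n = 0"; cases "n = 1") (auto intro!: derivative_eq_intros)
  then show ?thesis
    unfolding smooth_curve_def by (intro exI[of _ D]) (auto simp: D_def)
qed

text \<open>
  Tangent vectors are limits of difference quotients of points of the set.  The arguments below
  that bound a tangent space from above use only this weaker property.
\<close>
lemma tangent_space_sequence:
  assumes "w \<in> tangent_space M x"
  obtains X t where "\<And>n. X n \<in> M" "\<And>n. t n > 0" "t \<longlonglongrightarrow> 0" "X \<longlonglongrightarrow> x"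
    "(\<lambda>n. (1 / t n) *\<^sub>R (X n - x)) \<longlonglongrightarrow> w"
proof -
  obtain e c where e: "e > 0" "c ` {-e<..<e} \<subseteq> M" "c 0 = x"
    and c: "(c has_vector_derivative w) (at 0)"
    using assms unfolding tangent_space_def by blast
  define t where "t n = e / real (n + 2)" for n
  have t_pos: "t n > 0" for n
    using e(1) by (simp add: t_def)
  have t_less: "t n < e" for n
    using e(1) by (simp add: t_def field_simps add_pos_nonneg)
  have t_lim: "t \<longlonglongrightarrow> 0"
    unfolding t_def using LIMSEQ_ignore_initial_segment[OF lim_const_over_n[of e], of 2] by simp
  have "((\<lambda>h. norm (c h - x - h *\<^sub>R w) / \<bar>h\<bar>) \<longlongrightarrow> 0) (at 0)"
    using c e(3) by (simp add: has_vector_derivative_def has_derivative_iff_norm)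
  moreover have "\<forall>\<^sub>F h in at 0. norm (c h - x - h *\<^sub>R w) / \<bar>h\<bar> = norm ((1 / h) *\<^sub>R (c h - x) - w)"
    unfolding eventually_at_filter
  proof (intro always_eventually allI impI)
    fix h :: real
    assume "h \<noteq> 0"
    then have "(1 / h) *\<^sub>R (c h - x) - w = (1 / h) *\<^sub>R (c h - x - h *\<^sub>R w)"
      by (simp add: scaleR_diff_right)
    then show "norm (c h - x - h *\<^sub>R w) / \<bar>h\<bar> = norm ((1 / h) *\<^sub>R (c h - x) - w)"
      by simp
  qed
  ultimately have "((\<lambda>h. norm ((1 / h) *\<^sub>R (c h - x) - w)) \<longlongrightarrow> 0) (at 0)"
    by (rule Lim_transform_eventually)
  then have "((\<lambda>h. (1 / h) *\<^sub>R (c h - x)) \<longlongrightarrow> w) (at 0)"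
    by (intro LIM_zero_cancel[of _ w]) (rule tendsto_norm_zero_cancel)
  moreover have "filterlim t (at 0) sequentially"
    using t_lim t_pos by (auto simp: filterlim_at less_imp_neq[symmetric] order_less_imp_not_eq2)
  ultimately have quot: "(\<lambda>n. (1 / t n) *\<^sub>R (c (t n) - x)) \<longlonglongrightarrow> w"
    by (rule filterlim_compose)
  have "(\<lambda>n. x + t n *\<^sub>R ((1 / t n) *\<^sub>R (c (t n) - x))) \<longlonglongrightarrow> x + 0 *\<^sub>R w"
    by (intro tendsto_intros quot t_lim)
  then have "(\<lambda>n. c (t n)) \<longlonglongrightarrow> x"
    using t_pos by (simp add: less_imp_neq[symmetric] order_less_imp_not_eq2)
  moreover have "c (t n) \<in> M" for n
  proof -
    have "t n \<in> {-e<..<e}"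
      using t_pos[of n] t_less[of n] e(1) by simp
    with e(2) show ?thesis
      by blast
  qed
  ultimately show thesis
    using t_pos t_lim quot by (intro that[of "\<lambda>n. c (t n)" t]) auto
qed

lemmas blinfun_compose_right_linear =
  bounded_bilinear.bounded_linear_right[OF bounded_bilinear_blinfun_compose]

lemmas blinfun_compose_bilinear_simps =
  bounded_bilinear.scaleR_right[OF bounded_bilinear_blinfun_compose]
  bounded_bilinear.diff_right[OF bounded_bilinear_blinfun_compose]

lemma affine_apply_Pair [simp]: "affine_apply (b, L) x = b + L x"
  by (simp add: affine_apply_def)

context finite_basis
begin

text \<open>
  Surjectivity comes for free: a norm-preserving operator is injective, hence surjective in
  finite dimension.
\<close>
lemma Isom_iff: "(g :: 'v affine_map) \<in> Isom \<longleftrightarrow> snd g \<in> linear_isometries"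
proof
  assume "g \<in> Isom"
  then have "dist (affine_apply g x) (affine_apply g 0) = dist x 0" for x
    by (simp add: Isom_def isometries_def)
  then show "snd g \<in> linear_isometries"
    by (simp add: linear_isometries_def affine_apply_def dist_norm)
next
  assume iso: "snd g \<in> linear_isometries"
  have eq: "norm (snd g x - snd g y) = norm (x - y)" for x y
    using iso by (simp add: linear_isometries_def flip: blinfun.diff_right)
  have "inj (blinfun_apply (snd g))"
  proof (rule injI)
    fix x y assume "snd g x = snd g y"
    then show "x = y"
      using eq[of x y] by simp
  qed
  then have surj: "surj (blinfun_apply (snd g))"
    by (intro injective_imp_surjective bounded_linear.linear blinfun.bounded_linear_right)
  have "surj (affine_apply g)"
  proof (rule surjI)
    fix y
    show "affine_apply g (inv (snd g) (y - fst g)) = y"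
      using surj by (simp add: affine_apply_def surj_f_inv_f)
  qed
  then show "g \<in> Isom"
    by (simp add: Isom_def isometries_def affine_apply_def dist_norm eq)
qed

lemma linear_isometry_inverse:
  fixes L :: "'v \<Rightarrow>\<^sub>L 'v"
  assumes "L \<in> linear_isometries"
  obtains J where "J \<in> linear_isometries" "J o\<^sub>L L = id_blinfun" "L o\<^sub>L J = id_blinfun"
proof -
  have iso: "norm (L x) = norm x" for x
    using assms by (simp add: linear_isometries_def)
  have lin: "linear L"
    by (intro bounded_linear.linear blinfun.bounded_linear_right)
  have inj: "inj L"
  proof (rule injI)
    fix x y assume "L x = L y"
    then show "x = y"
      using iso[of "x - y"] by (simp add: blinfun.diff_right)
  qed
  with lin have surj: "surj L"
    by (rule injective_imp_surjective)
  have "linear (inv L)"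
    by (rule linearI; rule inv_f_eq[OF inj])
       (simp_all add: blinfun.add_right blinfun.scaleR_right surj_f_inv_f[OF surj])
  then have J: "blinfun_apply (Blinfun (inv L)) = inv L"
    by (intro bounded_linear_Blinfun_apply linear_imp_bounded_linear)
  show thesis
  proof (rule that)
    show "Blinfun (inv L) \<in> linear_isometries"
      using iso[of "inv L _"] by (simp add: linear_isometries_def J surj_f_inv_f[OF surj])
    show "Blinfun (inv L) o\<^sub>L L = id_blinfun"
      by (rule blinfun_eqI) (simp add: J inj)
    show "L o\<^sub>L Blinfun (inv L) = id_blinfun"
      by (rule blinfun_eqI) (simp add: J surj surj_f_inv_f)
  qed
qed

text \<open>
  The curve is the exponential $E(t) = \sum_n t^n W^n / n!$.  For fixed $x$ the curve $E(t) x$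
  solves $c' = W c$, so its norm is constant.
\<close>
lemma conservative_integrates_to_isometries:
  fixes W :: "'v \<Rightarrow>\<^sub>L 'v"
  assumes "W \<in> conservative"
  obtains E where "\<And>e. smooth_curve e E" "\<And>t. E t \<in> linear_isometries" "E 0 = id_blinfun"
    "(E has_vector_derivative W) (at 0)"
proof -
  obtain C :: "('v \<Rightarrow>\<^sub>L 'v) set" where "finite_basis C"
    using operator_basis_exists by blast
  then interpret ops: finite_basis C .
  define a where "a n = (((o\<^sub>L) W) ^^ n) id_blinfun" for n :: nat
  have a_simps: "a 0 = id_blinfun" "a (Suc n) = W o\<^sub>L a n" for n
    by (simp_all add: a_def)
  have norm_a: "norm (a n) \<le> norm W ^ n" for n
  proof (induction n)
    case (Suc n)
    have "norm (a (Suc n)) \<le> norm W * norm (a n)"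
      by (simp add: a_simps norm_blinfun_compose)
    also have "\<dots> \<le> norm W * norm W ^ n"
      by (intro mult_left_mono Suc) simp
    finally show ?case
      by simp
  qed (simp add: a_simps norm_blinfun_id_le)
  define D where "D k t = (\<Sum>n. (t ^ n / fact n) *\<^sub>R a (n + k))" for k t
  have bound: "norm (a (n + k)) \<le> norm W ^ k * norm W ^ n" for n k
    using norm_a[of "n + k"] by (simp add: power_add mult.commute)
  have D: "(D k has_vector_derivative D (Suc k) t) (at t)" for k t
    using ops.exponential_series(2)[of "\<lambda>n. a (n + k)", OF bound]
    by (simp add: D_def[abs_def])
  \<comment> \<open>Composition with $W$ is continuous, so it can be taken inside the series.\<close>
  have D_Suc: "D (Suc 0) t = W o\<^sub>L D 0 t" for t
  proof -
    have "summable (\<lambda>n. (t ^ n / fact n) *\<^sub>R a n)"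
      using ops.exponential_series(1)[of a 1 "norm W" t] norm_a by simp
    then have "W o\<^sub>L (\<Sum>n. (t ^ n / fact n) *\<^sub>R a n)
        = (\<Sum>n. W o\<^sub>L ((t ^ n / fact n) *\<^sub>R a n))"
      by (rule bounded_linear.suminf[OF blinfun_compose_right_linear])
    then show ?thesis
      by (simp add: D_def a_simps blinfun_compose_bilinear_simps)
  qed
  have D_0: "D 0 0 = id_blinfun"
    using suminf_finite[of "{0}" "\<lambda>n. (0 ^ n / fact n) *\<^sub>R a n"] by (simp add: D_def a_simps)
  have "norm (D 0 t x) = norm x" for t x
  proof -
    have "((\<lambda>t. D 0 t x) has_vector_derivative W (D 0 t x)) (at t)" for t
      using bounded_linear.has_vector_derivative[OF blinfun.bounded_linear_left D[of 0 t]]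
      by (simp add: D_Suc)
    from conservative_flow_preserves_norm[OF assms this] show ?thesis
      by (simp add: D_0)
  qed
  show thesis
  proof (rule that)
    show "smooth_curve e (D 0)" for e
      unfolding smooth_curve_def using D by (intro exI[of _ D]) simp
    show "D 0 t \<in> linear_isometries" for t
      by (simp add: linear_isometries_def \<open>\<And>x t. norm (D 0 t x) = norm x\<close>)
    have "D (Suc 0) 0 = W"
      by (simp add: D_Suc D_0 blinfun_eqI)
    then show "(D 0 has_vector_derivative W) (at 0)"
      using D[of 0 0] by simp
  qed (rule D_0)
qed

text \<open>
  A curve of isometries through $g = (b, L)$ becomes, after composing its linear part with
  $L^{-1}$, a curve of linear isometries through the identity, whose velocity is conservative.
  Conversely, $(b + t w, L e^{t W})$ is a smooth curve in the isometry group.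
\<close>
lemma tangent_space_Isom:
  fixes g :: "'v affine_map"
  assumes "g \<in> Isom"
  shows "tangent_space Isom g = {(w, snd g o\<^sub>L W) |w W. W \<in> conservative}"
proof safe
  have L: "snd g \<in> linear_isometries"
    using assms by (simp add: Isom_iff)
  {
    fix w U
    assume "(w, U) \<in> tangent_space Isom g"
    then obtain X t where X: "\<And>n. X n \<in> Isom" and t: "\<And>n. t n > 0" "t \<longlonglongrightarrow> 0" "X \<longlonglongrightarrow> g"
      and lim: "(\<lambda>n. (1 / t n) *\<^sub>R (X n - g)) \<longlonglongrightarrow> (w, U)"
      by (rule tangent_space_sequence) (blast intro: that)
    obtain J where J: "J \<in> linear_isometries" "J o\<^sub>L snd g = id_blinfun" "snd g o\<^sub>L J = id_blinfun"
      using L by (rule linear_isometry_inverse)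
    have "J o\<^sub>L U \<in> conservative"
    proof (rule limit_of_isometry_quotients_conservative)
      show "J o\<^sub>L snd (X n) \<in> linear_isometries" for n
        using J(1) X[of n] by (simp add: Isom_iff linear_isometries_def)
      have "(\<lambda>n. J o\<^sub>L snd (X n)) \<longlonglongrightarrow> (J o\<^sub>L snd g)"
        by (intro tendsto_intros t(3))
      then show "(\<lambda>n. J o\<^sub>L snd (X n)) \<longlonglongrightarrow> id_blinfun"
        by (simp add: J)
      have "(\<lambda>n. J o\<^sub>L snd ((1 / t n) *\<^sub>R (X n - g))) \<longlonglongrightarrow> (J o\<^sub>L snd (w, U))"
        by (intro tendsto_intros lim)
      then show "(\<lambda>n. (1 / t n) *\<^sub>R ((J o\<^sub>L snd (X n)) - id_blinfun)) \<longlonglongrightarrow> (J o\<^sub>L U)"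
        by (simp add: J(2)[symmetric] blinfun_compose_bilinear_simps)
    qed (rule t(1))
    moreover have "U = snd g o\<^sub>L (J o\<^sub>L U)"
      by (rule blinfun_eqI) (simp add: J(3) flip: blinfun_apply_blinfun_compose[of "snd g" J])
    ultimately show "\<exists>w' W. (w, U) = (w', snd g o\<^sub>L W) \<and> W \<in> conservative"
      by blast
  next
    fix w :: 'v and W :: "'v \<Rightarrow>\<^sub>L 'v"
    assume "W \<in> conservative"
    then obtain E where E: "\<And>e. smooth_curve e E" "\<And>t. E t \<in> linear_isometries"
      "E 0 = id_blinfun" "(E has_vector_derivative W) (at 0)"
      by (rule conservative_integrates_to_isometries) blast
    define c where "c t = (fst g, 0) + t *\<^sub>R (w, 0) + (0, snd g o\<^sub>L E t)" for t
    have lin: "bounded_linear (\<lambda>U. (0, snd g o\<^sub>L U))"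
      by (intro bounded_linear_Pair bounded_linear_zero blinfun_compose_right_linear)
    show "(w, snd g o\<^sub>L W) \<in> tangent_space Isom g"
      unfolding tangent_space_def
    proof (intro CollectI exI[of _ 1] exI[of _ c] conjI)
      show "smooth_curve 1 c"
        unfolding c_def
        by (intro smooth_curve_add smooth_curve_line smooth_curve_bounded_linear[OF lin] E(1))
      show "c ` {-1<..<1} \<subseteq> Isom"
        using L E(2) by (auto simp: c_def Isom_iff linear_isometries_def)
      show "c 0 = g"
        by (simp add: c_def E(3) prod_eq_iff blinfun_eqI)
      have "(c has_vector_derivative (w, 0) + (0, snd g o\<^sub>L W)) (at 0)"
        unfolding c_def
        by (intro has_vector_derivative_add bounded_linear.has_vector_derivative[OF lin] E(4))
           (auto intro!: derivative_eq_intros)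
      then show "(c has_vector_derivative (w, snd g o\<^sub>L W)) (at 0)"
        by simp
    qed simp
  }
qed

end

section \<open>Full placements\<close>

text \<open>
  An infinitesimal motion $x \mapsto u + W x$ with $W$ conservative that vanishes on $p$ has the
  same value $W p_v = - u$ at all $v$.  So the condition says that no nonzero infinitesimal
  motion fixes $p$; taking differences of entries eliminates $u$.
\<close>
definition infinitesimally_free :: "'a::real_normed_vector ^ 's \<Rightarrow> bool"
  where "infinitesimally_free p \<longleftrightarrow>
    (\<forall>W\<in>conservative. (\<forall>v v'. blinfun_apply W (p $ v - p $ v') = 0) \<longrightarrow> W = 0)"

lemma bounded_linear_componentwise:
  fixes f :: "'a::real_normed_vector \<Rightarrow> 'b::real_normed_vector ^ 's"
  assumes "\<And>v. bounded_linear (\<lambda>x. f x $ v)"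
  shows "bounded_linear f"
proof (rule bounded_linear_intro)
  show "f (x + y) = f x + f y" for x y
    by (simp add: vec_eq_iff linear_add[OF bounded_linear.linear[OF assms]])
  show "f (r *\<^sub>R x) = r *\<^sub>R f x" for r x
    by (simp add: vec_eq_iff linear_scale[OF bounded_linear.linear[OF assms]])
  show "norm (f x) \<le> norm x * (\<Sum>v\<in>UNIV. onorm (\<lambda>x. f x $ v))" for x
  proof -
    have "norm (f x) \<le> (\<Sum>v\<in>UNIV. norm (f x $ v))"
      unfolding norm_vec_def by (rule L2_set_le_sum) simp
    also have "\<dots> \<le> (\<Sum>v\<in>UNIV. onorm (\<lambda>x. f x $ v) * norm x)"
      by (intro sum_mono onorm assms)
    finally show ?thesis
      by (simp add: sum_distrib_left mult.commute)
  qed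
qed

lemma act_nth [simp]: "act h p $ v = affine_apply h (p $ v)"
  by (simp add: act_def)

lemma bounded_linear_act:
  fixes p :: "'a::real_normed_vector ^ 's"
  shows "bounded_linear (\<lambda>h. act h p)"
  unfolding act_def affine_apply_def
  by (rule bounded_linear_componentwise)
     (auto intro!: bounded_linear_add bounded_linear_fst
        bounded_linear_compose[OF blinfun.bounded_linear_left bounded_linear_snd])

lemma frechet_derivative_act:
  fixes p :: "'a::real_normed_vector ^ 's"
  shows "frechet_derivative (\<lambda>h. act h p) (at g) = (\<lambda>h. act h p)"
  using bounded_linear_imp_has_derivative[OF bounded_linear_act] by (rule frechet_derivative_at[symmetric])

lemma tangent_space_bounded_linear_image:
  assumes f: "bounded_linear f" and "f ` M \<subseteq> M'" "w \<in> tangent_space M x"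
  shows "f w \<in> tangent_space M' (f x)"
proof -
  obtain e c where e: "e > 0" "smooth_curve e c" "c ` {-e<..<e} \<subseteq> M" "c 0 = x"
    and c: "(c has_vector_derivative w) (at 0)"
    using assms(3) unfolding tangent_space_def by blast
  show ?thesis
    unfolding tangent_space_def
    using e c assms(2)
    by (intro CollectI exI[of _ e] exI[of _ "\<lambda>t. f (c t)"] conjI
        smooth_curve_bounded_linear[OF f] bounded_linear.has_vector_derivative[OF f]) auto
qed

context finite_basis
begin

text \<open>
  This replaces the theorem that orbits of a Lie group are submanifolds with tangent space the
  image of the Lie algebra.  The $N_n$ need not tend to the identity, but a subsequence
  tends to some isometry $N'$ that fixes all $d_i$, and $M_n = N_n N'^{-1}$ moves the $d_i$ exactly
  as $N_n$ does and tends to the identity.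
  
  The quotients $(M_n - 1) / t_n$ might be unbounded.  Dividing by $r_n = \|M_n - 1\| + t_n$ instead
  gives operators of norm at most $1$, and a subsequence tends to a conservative $V'$ with
  $V' d_i = \rho e_i$, where $\rho$ is the limit of $t_n / r_n = 1 - \|V_n\|$, that is,
  $\rho = 1 - \|V'\|$.  If $\rho$ were zero, then $V'$ would kill all $d_i$ and yet have norm $1$,
  against the hypothesis on the $d_i$.  So $W = V' / \rho$ is as required.
\<close>
lemma isometry_path_velocity:
  fixes N :: "nat \<Rightarrow> 'v \<Rightarrow>\<^sub>L 'v" and d e :: "'i \<Rightarrow> 'v"
  assumes N: "\<And>n. N n \<in> linear_isometries"
    and t: "\<And>n. t n > 0" "t \<longlonglongrightarrow> 0"
    and lim: "\<And>i. (\<lambda>n. (1 / t n) *\<^sub>R (N n (d i) - d i)) \<longlonglongrightarrow> e i"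
    and free: "\<And>W. W \<in> conservative \<Longrightarrow> (\<And>i. blinfun_apply W (d i) = 0) \<Longrightarrow> W = 0"
  shows "\<exists>W\<in>conservative. \<forall>i. blinfun_apply W (d i) = e i"
proof -
  obtain C :: "('v \<Rightarrow>\<^sub>L 'v) set" where "finite_basis C"
    using operator_basis_exists by blast
  then interpret ops: finite_basis C .
  have isoN: "norm (N n x) = norm x" for n x
    using N by (simp add: linear_isometries_def)
  have "norm (N n) \<le> 1" for n
    by (rule norm_blinfun_bound) (simp_all add: isoN)
  then obtain \<sigma> N' where \<sigma>: "strict_mono (\<sigma> :: nat \<Rightarrow> nat)" "(N \<circ> \<sigma>) \<longlonglongrightarrow> N'"
    by (rule ops.bounded_imp_convergent_subsequence)
  have N\<sigma>: "(\<lambda>n. N (\<sigma> n)) \<longlonglongrightarrow> N'"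
    using \<sigma>(2) by (simp add: o_def)
  have "norm (N' x) = norm x" for x
  proof -
    have "(\<lambda>n. norm (N (\<sigma> n) x)) \<longlonglongrightarrow> norm (N' x)"
      by (intro tendsto_intros N\<sigma>)
    then show ?thesis
      by (simp add: isoN LIMSEQ_const_iff)
  qed
  then obtain J where J: "J \<in> linear_isometries" "J o\<^sub>L N' = id_blinfun" "N' o\<^sub>L J = id_blinfun"
    using linear_isometry_inverse[of N'] by (auto simp: linear_isometries_def)
  have "N' (d i) = d i" for i
  proof -
    have "(\<lambda>n. d i + t n *\<^sub>R ((1 / t n) *\<^sub>R (N n (d i) - d i))) \<longlonglongrightarrow> d i + 0 *\<^sub>R e i"
      by (intro tendsto_intros t(2) lim)
    then have "(\<lambda>n. N n (d i)) \<longlonglongrightarrow> d i"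
      using t(1) by (simp add: less_imp_neq[symmetric] order_less_imp_not_eq2)
    from LIMSEQ_subseq_LIMSEQ[OF this \<sigma>(1)] have "(\<lambda>n. N (\<sigma> n) (d i)) \<longlonglongrightarrow> d i"
      by (simp add: o_def)
    moreover have "(\<lambda>n. N (\<sigma> n) (d i)) \<longlonglongrightarrow> N' (d i)"
      by (intro tendsto_intros N\<sigma>)
    ultimately show ?thesis
      by (metis LIMSEQ_unique)
  qed
  then have Jd: "J (d i) = d i" for i
    by (metis J(2) blinfun_apply_blinfun_compose blinfun_apply_id_blinfun)
  define M where "M n = N (\<sigma> n) o\<^sub>L J" for n
  have M: "M n \<in> linear_isometries" for n
    using J(1) N[of "\<sigma> n"] by (simp add: M_def linear_isometries_def)
  have "(\<lambda>n. N (\<sigma> n) o\<^sub>L J) \<longlonglongrightarrow> (N' o\<^sub>L J)"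
    by (intro tendsto_intros N\<sigma>)
  then have M_lim: "M \<longlonglongrightarrow> id_blinfun"
    by (simp add: M_def[abs_def] J(3))
  define r where "r n = norm (M n - id_blinfun) + t (\<sigma> n)" for n
  have r: "r n > 0" for n
    using t(1)[of "\<sigma> n"] by (simp add: r_def add_nonneg_pos)
  define V where "V n = (1 / r n) *\<^sub>R (M n - id_blinfun)" for n
  have norm_V: "norm (V n) = 1 - t (\<sigma> n) / r n" for n
  proof -
    have "norm (V n) = norm (M n - id_blinfun) / r n"
      using r[of n] by (simp add: V_def)
    also have "norm (M n - id_blinfun) = r n - t (\<sigma> n)"
      by (simp add: r_def)
    finally show ?thesis
      using r[of n] by (simp add: diff_divide_distrib)
  qed
  then have "norm (V n) \<le> 1" for n
    using r[of n] t(1)[of "\<sigma> n"] by simp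
  then obtain \<pi> V' where \<pi>: "strict_mono (\<pi> :: nat \<Rightarrow> nat)" "(V \<circ> \<pi>) \<longlonglongrightarrow> V'"
    by (rule ops.bounded_imp_convergent_subsequence)
  have V\<pi>: "(\<lambda>n. V (\<pi> n)) \<longlonglongrightarrow> V'"
    using \<pi>(2) by (simp add: o_def)
  have V': "V' \<in> conservative"
  proof (rule limit_of_isometry_quotients_conservative)
    show "(\<lambda>n. M (\<pi> n)) \<longlonglongrightarrow> id_blinfun"
      using LIMSEQ_subseq_LIMSEQ[OF M_lim \<pi>(1)] by (simp add: o_def)
    show "(\<lambda>n. (1 / r (\<pi> n)) *\<^sub>R (M (\<pi> n) - id_blinfun)) \<longlonglongrightarrow> V'"
      using V\<pi> by (simp add: V_def)
  qed (rule M r)+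
  have V'd: "V' (d i) = (1 - norm V') *\<^sub>R e i" for i
  proof -
    have "V n (d i) = (1 - norm (V n)) *\<^sub>R ((1 / t (\<sigma> n)) *\<^sub>R (N (\<sigma> n) (d i) - d i))" for n
      unfolding norm_V using t(1)[of "\<sigma> n"]
      by (simp add: V_def M_def blinfun.scaleR_left blinfun.diff_left Jd)
    moreover have "(\<lambda>n. (1 / t (\<sigma> (\<pi> n))) *\<^sub>R (N (\<sigma> (\<pi> n)) (d i) - d i)) \<longlonglongrightarrow> e i"
      using LIMSEQ_subseq_LIMSEQ[OF lim[of i] strict_mono_o[OF \<sigma>(1) \<pi>(1)]] by (simp add: o_def)
    then have "(\<lambda>n. (1 - norm (V (\<pi> n))) *\<^sub>R ((1 / t (\<sigma> (\<pi> n))) *\<^sub>R (N (\<sigma> (\<pi> n)) (d i) - d i)))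
        \<longlonglongrightarrow> (1 - norm V') *\<^sub>R e i"
      by (intro tendsto_intros V\<pi>)
    ultimately have "(\<lambda>n. V (\<pi> n) (d i)) \<longlonglongrightarrow> (1 - norm V') *\<^sub>R e i"
      by simp
    moreover have "(\<lambda>n. V (\<pi> n) (d i)) \<longlonglongrightarrow> V' (d i)"
      by (intro tendsto_intros V\<pi>)
    ultimately show ?thesis
      by (metis LIMSEQ_unique)
  qed
  have "norm V' \<noteq> 1"
    using free[OF V'] V'd by force
  then have "\<forall>i. ((1 / (1 - norm V')) *\<^sub>R V') (d i) = e i"
    by (simp add: blinfun.scaleR_left V'd)
  moreover have "(1 / (1 - norm V')) *\<^sub>R V' \<in> conservative"
    by (intro subspace_scale subspace_conservative V')
  ultimately show ?thesis
    by blast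
qed

text \<open>
  Injectivity of the differential at the identity suffices: if $W$ takes the same value at all
  $p_v$, then $(- W p_v, W)$ and $0$ are tangent vectors with the same image.
\<close>
lemma full_placement_imp_infinitesimally_free:
  fixes p :: "'v ^ 's"
  assumes "full_placement p"
  shows "infinitesimally_free p"
  unfolding infinitesimally_free_def
proof (intro ballI impI)
  fix W :: "'v \<Rightarrow>\<^sub>L 'v"
  assume W: "W \<in> conservative" "\<forall>v v'. W (p $ v - p $ v') = 0"
  have g: "(0, id_blinfun) \<in> (Isom :: 'v affine_map set)"
    by (simp add: Isom_iff linear_isometries_def)
  define w where "w = - W (p $ undefined)"
  have inj: "inj_on (\<lambda>h. act h p) (tangent_space Isom (0, id_blinfun))"
    using assms g unfolding full_placement_def frechet_derivative_act
    by (blast dest: bij_betw_imp_inj_on)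
  have "act (w, W) p = act (0, 0) p"
    using W(2) by (simp add: vec_eq_iff w_def blinfun.diff_right)
  moreover have "(u, U) \<in> tangent_space Isom (0, id_blinfun)" if "U \<in> conservative"
    for u and U :: "'v \<Rightarrow>\<^sub>L 'v"
    using that unfolding tangent_space_Isom[OF g] by (auto intro!: exI[of _ U] blinfun_eqI)
  ultimately have "(w, W) = (0, 0)"
    using W(1) subspace_0[OF subspace_conservative] by (intro inj_onD[OF inj]) auto
  then show "W = 0"
    by simp
qed

text \<open>
  The differential at $g = (b, L)$ sends $(w, L W)$ to $(w + L W p_v)_v$, so two tangent vectors
  with the same image differ by an operator $W$ that kills all differences $p_v - p_{v'}$; this
  gives injectivity.  For surjectivity, points of the orbit close to $g . p$ are $h_n . p$
  with isometries $h_n$; composing their linear parts with $L^{-1}$ and looking at differences of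
  entries reduces the claim to the velocity lemma for linear isometries.
\<close>
lemma infinitesimally_free_imp_full_placement:
  fixes p :: "'v ^ 's"
  assumes free: "infinitesimally_free p"
  shows "full_placement p"
  unfolding full_placement_def frechet_derivative_act
proof
  fix g :: "'v affine_map"
  assume g: "g \<in> Isom"
  define L where "L = snd g"
  have L: "L \<in> linear_isometries"
    using g by (simp add: Isom_iff L_def)
  have tangent: "tangent_space Isom g = {(w, L o\<^sub>L W) |w W. W \<in> conservative}"
    using tangent_space_Isom[OF g] by (simp add: L_def)
  obtain J where J: "J \<in> linear_isometries" "J o\<^sub>L L = id_blinfun" "L o\<^sub>L J = id_blinfun"
    using L by (rule linear_isometry_inverse)
  have JL: "J (L x) = x" and LJ: "L (J x) = x" for x
    using J(2,3) by (metis blinfun_apply_blinfun_compose blinfun_apply_id_blinfun)+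
  show "bij_betw (\<lambda>h. act h p) (tangent_space Isom g) (tangent_space (orbit p) (act g p))"
  proof (rule bij_betw_imageI)
    show "inj_on (\<lambda>h. act h p) (tangent_space Isom g)"
    proof (rule inj_onI)
      fix h h'
      assume h: "h \<in> tangent_space Isom g" "h' \<in> tangent_space Isom g" and eq: "act h p = act h' p"
      obtain w W where W: "h = (w, L o\<^sub>L W)" "W \<in> conservative"
        using h(1) unfolding tangent by blast
      obtain w' W' where W': "h' = (w', L o\<^sub>L W')" "W' \<in> conservative"
        using h(2) unfolding tangent by blast
      have eq_v: "w + L (W (p $ v)) = w' + L (W' (p $ v))" for v
        using eq by (simp add: vec_eq_iff W W')
      have "(W - W') (p $ v - p $ v') = 0" for v v'
      proof -
        have "L (W (p $ v - p $ v')) = L (W' (p $ v - p $ v'))"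
        proof -
          have "L (W (p $ v - p $ v')) = (w + L (W (p $ v))) - (w + L (W (p $ v')))"
            by (simp add: blinfun.diff_right)
          also have "\<dots> = L (W' (p $ v - p $ v'))"
            unfolding eq_v by (simp add: blinfun.diff_right)
          finally show ?thesis .
        qed
        then have "J (L (W (p $ v - p $ v'))) = J (L (W' (p $ v - p $ v')))"
          by simp
        then show ?thesis
          by (simp add: JL blinfun.diff_left)
      qed
      moreover have "W - W' \<in> conservative"
        by (intro subspace_diff subspace_conservative W W')
      ultimately have "W - W' = 0"
        using free unfolding infinitesimally_free_def by blast
      with eq_v[of undefined] show "h = h'"
        by (simp add: W W')
    qed
    show "(\<lambda>h. act h p) ` tangent_space Isom g = tangent_space (orbit p) (act g p)"
    proof
      show "(\<lambda>h. act h p) ` tangent_space Isom g \<subseteq> tangent_space (orbit p) (act g p)"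
        by (intro image_subsetI tangent_space_bounded_linear_image[OF bounded_linear_act, of _ Isom])
           (simp_all add: orbit_def)
      show "tangent_space (orbit p) (act g p) \<subseteq> (\<lambda>h. act h p) ` tangent_space Isom g"
      proof
        fix z
        assume "z \<in> tangent_space (orbit p) (act g p)"
        then obtain X t where X: "\<And>n. X n \<in> orbit p" and t: "\<And>n. t n > 0" "t \<longlonglongrightarrow> 0"
          and lim: "(\<lambda>n. (1 / t n) *\<^sub>R (X n - act g p)) \<longlonglongrightarrow> z"
          by (rule tangent_space_sequence) (blast intro: that)
        have "\<forall>n. \<exists>h\<in>Isom. X n = act h p"
          using X unfolding orbit_def by blast
        then obtain h where h: "\<And>n. h n \<in> Isom" "\<And>n. X n = act (h n) p"
          by metis
        define N where "N n = J o\<^sub>L snd (h n)" for n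
        have "\<exists>W\<in>conservative. \<forall>i. blinfun_apply W ((\<lambda>(v, v'). p $ v - p $ v') i)
            = (\<lambda>(v, v'). J (z $ v - z $ v')) i"
        proof (rule isometry_path_velocity[OF _ t])
          show "N n \<in> linear_isometries" for n
            using J(1) h(1)[of n] by (simp add: N_def Isom_iff linear_isometries_def)
          show "W = 0" if "W \<in> conservative"
            "\<And>i. blinfun_apply W ((\<lambda>(v, v'). p $ v - p $ v') i) = 0" for W
          proof -
            have "W (p $ v - p $ v') = 0" for v v'
              using that(2)[of "(v, v')"] by simp
            then show ?thesis
              using free that(1) unfolding infinitesimally_free_def by blast
          qed
          show "(\<lambda>n. (1 / t n) *\<^sub>R (N n ((\<lambda>(v, v'). p $ v - p $ v') i)
              - (\<lambda>(v, v'). p $ v - p $ v') i)) \<longlonglongrightarrow> (\<lambda>(v, v'). J (z $ v - z $ v')) i" for i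
          proof -
            obtain v v' where i: "i = (v, v')"
              by (cases i)
            let ?Q = "\<lambda>n. (1 / t n) *\<^sub>R (X n - act g p)"
            have "(\<lambda>n. J (?Q n $ v - ?Q n $ v')) \<longlonglongrightarrow> J (z $ v - z $ v')"
              by (intro tendsto_intros lim)
            moreover have "J (?Q n $ v - ?Q n $ v')
                = (1 / t n) *\<^sub>R (N n (p $ v - p $ v') - (p $ v - p $ v'))" for n
            proof -
              have "?Q n $ v - ?Q n $ v'
                  = (1 / t n) *\<^sub>R (snd (h n) (p $ v - p $ v') - L (p $ v - p $ v'))"
                by (simp add: h(2) L_def affine_apply_def blinfun.diff_right algebra_simps)
              then show ?thesis
                by (simp add: N_def blinfun.scaleR_right blinfun.diff_right JL)
            qed
            ultimately show ?thesis
              by (simp add: i)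
          qed
        qed
        then obtain W where W: "W \<in> conservative" "\<And>v v'. W (p $ v - p $ v') = J (z $ v - z $ v')"
          by force
        \<comment> \<open>The translational part is read off at an arbitrary base point.\<close>
        define w where "w = z $ undefined - L (W (p $ undefined))"
        have "act (w, L o\<^sub>L W) p = z"
        proof (rule vec_eq_iff[THEN iffD2], rule allI)
          fix v
          have "act (w, L o\<^sub>L W) p $ v = z $ undefined + L (W (p $ v - p $ undefined))"
            by (simp add: w_def blinfun.diff_right)
          then show "act (w, L o\<^sub>L W) p $ v = z $ v"
            by (simp add: W(2) LJ)
        qed
        with W(1) show "z \<in> (\<lambda>h. act h p) ` tangent_space Isom g"
          unfolding tangent by blast
      qed
    qed
  qed
qed

lemma Full_eq: "(Full :: ('v ^ 's) set) = {p. infinitesimally_free p}"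
  unfolding Full_def
  using full_placement_imp_infinitesimally_free infinitesimally_free_imp_full_placement by blast

text \<open>
  The complement is closed: conservative operators of norm $1$ that witness the failure for
  $X_n \to p$ have a convergent subsequence, and the limit is a witness for $p$.
\<close>
lemma open_infinitesimally_free: "open {p :: 'v ^ 's. infinitesimally_free p}"
proof -
  obtain C :: "('v \<Rightarrow>\<^sub>L 'v) set" where "finite_basis C"
    using operator_basis_exists by blast
  then interpret ops: finite_basis C .
  have "closed {p :: 'v ^ 's. \<not> infinitesimally_free p}"
    unfolding closed_sequential_limits
  proof (intro allI impI)
    fix X and p :: "'v ^ 's"
    assume "(\<forall>n. X n \<in> {p. \<not> infinitesimally_free p}) \<and> X \<longlonglongrightarrow> p"
    then have "\<forall>n. \<not> infinitesimally_free (X n)" and X: "X \<longlonglongrightarrow> p"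
      by auto
    then have "\<exists>W. W \<in> conservative \<and> (\<forall>v v'. blinfun_apply W (X n $ v - X n $ v') = 0) \<and> W \<noteq> 0" for n
      unfolding infinitesimally_free_def by blast
    then have "\<exists>W. \<forall>n. W n \<in> conservative \<and>
        (\<forall>v v'. blinfun_apply (W n) (X n $ v - X n $ v') = 0) \<and> W n \<noteq> 0"
      by (intro choice allI)
    then obtain W where W: "\<And>n. W n \<in> conservative"
      "\<And>n v v'. blinfun_apply (W n) (X n $ v - X n $ v') = 0" "\<And>n. W n \<noteq> 0"
      by blast
    define U where "U n = (1 / norm (W n)) *\<^sub>R W n" for n
    have norm_U: "norm (U n) = 1" for n
      using W(3) by (simp add: U_def)
    then have "norm (U n) \<le> 1" for n
      by simp
    then obtain \<sigma> U' where \<sigma>: "strict_mono (\<sigma> :: nat \<Rightarrow> nat)" "(U \<circ> \<sigma>) \<longlonglongrightarrow> U'"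
      by (rule ops.bounded_imp_convergent_subsequence)
    have U\<sigma>: "(\<lambda>n. U (\<sigma> n)) \<longlonglongrightarrow> U'"
      using \<sigma>(2) by (simp add: o_def)
    have X\<sigma>: "(\<lambda>n. X (\<sigma> n)) \<longlonglongrightarrow> p"
      using LIMSEQ_subseq_LIMSEQ[OF X \<sigma>(1)] by (simp add: o_def)
    have "U n \<in> conservative" for n
      unfolding U_def by (intro subspace_scale subspace_conservative W)
    then have "U' \<in> conservative"
      using closed_sequentially[OF closed_conservative _ U\<sigma>] by simp
    moreover have "U' (p $ v - p $ v') = 0" for v v'
    proof -
      have "(\<lambda>n. U (\<sigma> n) (X (\<sigma> n) $ v - X (\<sigma> n) $ v')) \<longlonglongrightarrow> U' (p $ v - p $ v')"
        by (intro tendsto_intros U\<sigma> X\<sigma>)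
      then show ?thesis
        by (simp add: U_def blinfun.scaleR_left W(2) LIMSEQ_const_iff)
    qed
    moreover have "(\<lambda>n. norm (U (\<sigma> n))) \<longlonglongrightarrow> norm U'"
      by (intro tendsto_intros U\<sigma>)
    then have "U' \<noteq> 0"
      by (auto simp: norm_U LIMSEQ_const_iff)
    ultimately show "p \<in> {p. \<not> infinitesimally_free p}"
      unfolding infinitesimally_free_def by blast
  qed
  then show ?thesis
    by (simp add: closed_def Collect_neg_eq)
qed

end

section \<open>Genericity along lines\<close>

context finite_basis
begin

text \<open>
  Eigenvectors for distinct eigenvalues are independent, so there are at most as many
  eigenvalues as basis vectors.
\<close>
lemma finite_eigenvalues:
  fixes T :: "'v \<Rightarrow> 'v"
  assumes T: "linear T"
  shows "finite {t. \<exists>x. x \<noteq> 0 \<and> T x = t *\<^sub>R x}"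
proof (rule ccontr)
  let ?E = "{t. \<exists>x. x \<noteq> 0 \<and> T x = t *\<^sub>R x}"
  assume "infinite ?E"
  then obtain A where A: "A \<subseteq> ?E" "finite A" "card A = card B + 1"
    using infinite_arbitrarily_large by blast
  from A(1) have "\<forall>t\<in>A. \<exists>x. x \<noteq> 0 \<and> T x = t *\<^sub>R x"
    by blast
  then obtain x where x: "\<And>t. t \<in> A \<Longrightarrow> x t \<noteq> 0" "\<And>t. t \<in> A \<Longrightarrow> T (x t) = t *\<^sub>R x t"
    by metis
  \<comment> \<open>Independence by induction on the set of eigenvalues: applying $T - s$ to a vanishing
    combination removes the eigenvector of $s$.\<close>
  have zero: "\<forall>t\<in>A'. c t = 0" if "finite A'" "A' \<subseteq> A" "(\<Sum>t\<in>A'. c t *\<^sub>R x t) = 0" for A' c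
    using that
  proof (induction A' arbitrary: c rule: finite_induct)
    case (insert s A')
    have "0 = T (\<Sum>t\<in>insert s A'. c t *\<^sub>R x t) - s *\<^sub>R (\<Sum>t\<in>insert s A'. c t *\<^sub>R x t)"
      using insert.prems(2) by (simp add: linear_0[OF T])
    also have "T (\<Sum>t\<in>insert s A'. c t *\<^sub>R x t) = (\<Sum>t\<in>insert s A'. (c t * t) *\<^sub>R x t)"
    proof -
      have "c t *\<^sub>R T (x t) = (c t * t) *\<^sub>R x t" if "t \<in> insert s A'" for t
        using x(2)[of t] that insert.prems(1) by auto
      then show ?thesis
        unfolding linear_sum[OF T] linear_scale[OF T] by (rule sum.cong[OF refl])
    qed
    also have "\<dots> - s *\<^sub>R (\<Sum>t\<in>insert s A'. c t *\<^sub>R x t)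
        = (\<Sum>t\<in>insert s A'. (c t * (t - s)) *\<^sub>R x t)"
      unfolding scaleR_sum_right sum_subtractf[symmetric]
      by (rule sum.cong) (simp_all add: algebra_simps)
    also have "\<dots> = (\<Sum>t\<in>A'. (c t * (t - s)) *\<^sub>R x t)"
      using insert.hyps by simp
    finally have "\<forall>t\<in>A'. c t * (t - s) = 0"
      using insert.prems(1) by (intro insert.IH) auto
    then have "\<forall>t\<in>A'. c t = 0"
      using insert.hyps(2) by auto
    moreover from this have "c s *\<^sub>R x s = 0"
      using insert.prems(2) insert.hyps by simp
    then have "c s = 0"
      using x(1)[of s] insert.prems(1) by simp
    ultimately show ?case
      by simp
  qed simp
  have inj: "inj_on x A"
  proof (rule inj_onI)
    fix s t assume st: "s \<in> A" "t \<in> A" "x s = x t"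
    then have "s *\<^sub>R x s = t *\<^sub>R x s"
      using x(2)[of s] x(2)[of t] by auto
    with x(1)[OF st(1)] show "s = t"
      by simp
  qed
  have "independent (x ` A)"
  proof (rule real_vector.independent_if_scalars_zero)
    fix f v assume "(\<Sum>v\<in>x ` A. f v *\<^sub>R v) = 0" and v: "v \<in> x ` A"
    then have "(\<Sum>t\<in>A. f (x t) *\<^sub>R x t) = 0"
      by (simp add: sum.reindex[OF inj])
    with zero[of A "\<lambda>t. f (x t)"] A(2) v show "f v = 0"
      by auto
  qed (use A(2) in simp)
  then have "card (x ` A) \<le> card B"
    using real_vector.independent_span_bound[OF finite_B] span_B by auto
  then show False
    using A(3) by (simp add: card_image[OF inj])
qed

lemma blinfun_eq_on_basis:
  fixes U V :: "'v \<Rightarrow>\<^sub>L 'w::real_normed_vector"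
  assumes "\<And>b. b \<in> B \<Longrightarrow> U b = V b"
  shows "U = V"
proof (rule blinfun_eqI)
  fix x
  have "U (\<Sum>b\<in>B. coord b x *\<^sub>R b) = V (\<Sum>b\<in>B. coord b x *\<^sub>R b)"
    by (simp add: blinfun.sum_right blinfun.scaleR_right assms)
  then show "U x = V x"
    by (simp add: sum_coord)
qed

lemma independent_placements_finite:
  fixes C :: "('v ^ 's) set"
  assumes "independent C"
  shows "finite C"
proof -
  define G where "G = (\<lambda>(v, b). axis v b :: 'v ^ 's) ` (UNIV \<times> B)"
  have "p \<in> span G" for p
  proof -
    have "p = (\<Sum>v\<in>UNIV. \<Sum>b\<in>B. coord b (p $ v) *\<^sub>R axis v b)"
    proof (rule vec_eq_iff[THEN iffD2], rule allI)
      fix w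
      have "(\<Sum>b\<in>B. coord b (p $ v) *\<^sub>R axis v b $ w) = (if v = w then p $ v else 0)" for v
        by (cases "v = w") (simp_all add: axis_def sum_coord)
      then have "(\<Sum>v\<in>UNIV. \<Sum>b\<in>B. coord b (p $ v) *\<^sub>R axis v b) $ w
          = (\<Sum>v\<in>UNIV. if v = w then p $ v else 0)"
        by simp
      then show "p $ w = (\<Sum>v\<in>UNIV. \<Sum>b\<in>B. coord b (p $ v) *\<^sub>R axis v b) $ w"
        by simp
    qed
    moreover have "(\<Sum>v\<in>UNIV. \<Sum>b\<in>B. coord b (p $ v) *\<^sub>R axis v b) \<in> span G"
      by (intro real_vector.span_sum real_vector.span_scale real_vector.span_base)
         (auto simp: G_def)
    ultimately show ?thesis
      by simp
  qed
  moreover have "finite G"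
    using finite_B by (simp add: G_def)
  ultimately show ?thesis
    using real_vector.independent_span_bound[of G C] assms by blast
qed

text \<open>
  Let $q$ have the entry $0$ at $v_0$ and list the basis at further places $f(b)$; this is where
  the bound on the number of points enters.  Suppose $W \neq 0$ shows that $p + t q$ is not
  infinitesimally free, and let $R$ be the operator with $R b = p_{f(b)} - p_{v_0}$.  Then
  $W (R b + t b) = 0$ for all basis vectors $b$, that is, $W R = - t W$.  So $-t$ is an eigenvalue
  of the linear map $W \mapsto W R$ on the space of operators, and only finitely many $t$ occur.
\<close>
lemma infinitesimally_free_generic_on_lines:
  assumes card: "card B + 1 \<le> CARD('s::finite)"
  shows "\<exists>q :: 'v ^ 's. \<forall>p. finite {t. \<not> infinitesimally_free (p + t *\<^sub>R q)}"
proof -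
  obtain C :: "('v \<Rightarrow>\<^sub>L 'v) set" where "finite_basis C"
    using operator_basis_exists by blast
  then interpret ops: finite_basis C .
  \<comment> \<open>An arbitrary base point; the index type is nonempty.\<close>
  define v0 :: 's where "v0 = undefined"
  have "card B \<le> card (UNIV - {v0})"
    using card by (simp add: card_Diff_singleton)
  then obtain f where f: "f ` B \<subseteq> UNIV - {v0}" "inj_on f B"
    using card_le_inj[OF finite_B finite_Diff[OF finite]] by blast
  define q :: "'v ^ 's" where "q = (\<chi> v. if v \<in> f ` B then the_inv_into B f v else 0)"
  have q_f: "q $ f b = b" if "b \<in> B" for b
    using that f(2) by (simp add: q_def the_inv_into_f_f)
  have q_v0: "q $ v0 = 0"
    using f(1) by (auto simp: q_def)
  have "finite {t. \<not> infinitesimally_free (p + t *\<^sub>R q)}" for p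
  proof -
    define R where "R = Blinfun (\<lambda>x. \<Sum>b\<in>B. coord b x *\<^sub>R (p $ f b - p $ v0))"
    have R: "R b = p $ f b - p $ v0" if "b \<in> B" for b
    proof -
      have "bounded_linear (\<lambda>x. \<Sum>b\<in>B. coord b x *\<^sub>R (p $ f b - p $ v0))"
        by (intro bounded_linear_sum bounded_linear_scaleR_const bounded_linear_coord)
      then have "R b = (\<Sum>b'\<in>B. coord b' b *\<^sub>R (p $ f b' - p $ v0))"
        by (simp add: R_def bounded_linear_Blinfun_apply)
      also have "\<dots> = (\<Sum>b'\<in>B. if b' = b then p $ f b' - p $ v0 else 0)"
        using that by (intro sum.cong) (simp_all add: coord_basis)
      finally show ?thesis
        using that finite_B by simp
    qed
    define E where "E = {s. \<exists>W :: 'v \<Rightarrow>\<^sub>L 'v. W \<noteq> 0 \<and> (W o\<^sub>L R) = s *\<^sub>R W}"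
    have "linear (\<lambda>W :: 'v \<Rightarrow>\<^sub>L 'v. W o\<^sub>L R)"
      by (rule bounded_linear.linear[OF
            bounded_bilinear.bounded_linear_left[OF bounded_bilinear_blinfun_compose]])
    from ops.finite_eigenvalues[OF this] have "finite E"
      unfolding E_def .
    moreover have "{t. \<not> infinitesimally_free (p + t *\<^sub>R q)} \<subseteq> uminus ` E"
    proof safe
      fix t
      assume "\<not> infinitesimally_free (p + t *\<^sub>R q)"
      then obtain W :: "'v \<Rightarrow>\<^sub>L 'v" where W: "W \<noteq> 0"
        "\<And>v v'. blinfun_apply W ((p + t *\<^sub>R q) $ v - (p + t *\<^sub>R q) $ v') = 0"
        unfolding infinitesimally_free_def by blast
      have "W o\<^sub>L R = (- t) *\<^sub>R W"
      proof (rule blinfun_eq_on_basis)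
        fix b assume b: "b \<in> B"
        have "(p + t *\<^sub>R q) $ f b - (p + t *\<^sub>R q) $ v0 = R b + t *\<^sub>R b"
          by (simp add: R b q_f q_v0)
        with W(2)[of "f b" v0] have "W (R b) + t *\<^sub>R W b = 0"
          by (simp add: blinfun.add_right blinfun.scaleR_right)
        then have "W (R b) = - (t *\<^sub>R W b)"
          by (rule eq_neg_iff_add_eq_0[THEN iffD2])
        then show "(W o\<^sub>L R) b = ((- t) *\<^sub>R W) b"
          by (simp add: blinfun.scaleR_left blinfun.minus_left)
      qed
      with W(1) have "- t \<in> E"
        unfolding E_def by (intro CollectI exI[of _ W] conjI)
      then show "t \<in> uminus ` E"
        by (rule rev_image_eqI) simp
    qed
    ultimately show ?thesis
      by (rule finite_surj)
  qed
  then show ?thesis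
    by blast
qed

end

section \<open>Null sets for the Lebesgue measure of a basis\<close>

context finite_basis
begin

text \<open>
  The preimage of an open set is open in the space of coefficients, hence a countable union of
  boxes with rational centres and sizes.
\<close>
lemma combination_measurable:
  "(\<lambda>c. \<Sum>b\<in>B. c b *\<^sub>R b) \<in> measurable (Pi\<^sub>M B (\<lambda>_. lborel)) borel"
proof (rule borel_measurableI)
  fix U :: "'v set"
  assume U: "open U"
  define G where "G c = (\<Sum>b\<in>B. c b *\<^sub>R b)" for c :: "'v \<Rightarrow> real"
  define box where "box c r = PiE B (\<lambda>b. {c b - r<..<c b + r})" for c :: "'v \<Rightarrow> real" and r
  define I where "I = {(c, r). c \<in> PiE B (\<lambda>_. \<rat>) \<and> r \<in> \<rat> \<and> box c r \<subseteq> G -` U}"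
  have "countable I"
    by (rule countable_subset[of _ "PiE B (\<lambda>_. \<rat>) \<times> \<rat>"])
       (auto simp: I_def intro!: countable_PiE finite_B countable_rat)
  moreover have "box c r \<in> sets (Pi\<^sub>M B (\<lambda>_. lborel))" for c r
    unfolding box_def by (intro sets_PiM_I_finite finite_B) simp
  ultimately have "(\<Union>(c, r)\<in>I. box c r) \<in> sets (Pi\<^sub>M B (\<lambda>_. lborel))"
    by (intro sets.countable_UN') auto
  also have "(\<Union>(c, r)\<in>I. box c r) = G -` U \<inter> space (Pi\<^sub>M B (\<lambda>_. lborel))"
  proof
    show "(\<Union>(c, r)\<in>I. box c r) \<subseteq> G -` U \<inter> space (Pi\<^sub>M B (\<lambda>_. lborel))"
      by (auto simp: I_def box_def space_PiM PiE_def)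
    show "G -` U \<inter> space (Pi\<^sub>M B (\<lambda>_. lborel)) \<subseteq> (\<Union>(c, r)\<in>I. box c r)"
    proof
      fix c
      assume c: "c \<in> G -` U \<inter> space (Pi\<^sub>M B (\<lambda>_. lborel))"
      then have ext: "c \<in> extensional B"
        by (simp add: space_PiM PiE_def)
      obtain \<epsilon> where \<epsilon>: "\<epsilon> > 0" "\<And>y. dist y (G c) < \<epsilon> \<Longrightarrow> y \<in> U"
        using U c unfolding open_dist by auto
      \<comment> \<open>Moving each coefficient by at most $2 r$ moves the vector by at most $2 r K$.  The
        summand $1$ keeps $K$ positive when the basis is empty.\<close>
      define K where "K = (\<Sum>b\<in>B. norm b) + 1"
      have K: "K > 0"
        unfolding K_def by (intro add_nonneg_pos sum_nonneg) auto
      obtain r where r: "r \<in> \<rat>" "0 < r" "r < \<epsilon> / (2 * K)"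
        using Rats_dense_in_real[of 0 "\<epsilon> / (2 * K)"] \<epsilon>(1) K by auto
      have "\<exists>s\<in>\<rat>. \<bar>s - c b\<bar> < r" for b
      proof -
        obtain s where "s \<in> \<rat>" "c b - r < s" "s < c b + r"
          using Rats_dense_in_real[of "c b - r" "c b + r"] r(2) by auto
        then show ?thesis
          by (intro bexI[of _ s]) auto
      qed
      then obtain s where s: "\<And>b. s b \<in> \<rat>" "\<And>b. \<bar>s b - c b\<bar> < r"
        by metis
      have "box (restrict s B) r \<subseteq> G -` U"
      proof
        fix c'
        assume c': "c' \<in> box (restrict s B) r"
        have "\<bar>c' b - c b\<bar> \<le> 2 * r" if "b \<in> B" for b
        proof -
          have "\<bar>c' b - s b\<bar> < r"
            using PiE_mem[OF c'[unfolded box_def] that] that by (auto simp: abs_less_iff)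
          with s(2)[of b] show ?thesis
            by linarith
        qed
        then have "norm (G c' - G c) \<le> (\<Sum>b\<in>B. 2 * r * norm b)"
          unfolding G_def sum_subtractf[symmetric] scaleR_diff_left[symmetric]
          by (intro sum_norm_le) (simp add: mult_right_mono)
        also have "\<dots> \<le> 2 * r * K"
          unfolding K_def sum_distrib_left[symmetric] using r(2) by (intro mult_left_mono) auto
        also have "\<dots> < \<epsilon>"
          using r(3) K by (simp add: field_simps)
        finally show "c' \<in> G -` U"
          using \<epsilon>(2) by (simp add: dist_norm)
      qed
      then have "(restrict s B, r) \<in> I"
        using s(1) r(1) by (simp add: I_def)
      moreover have "c \<in> box (restrict s B) r"
      proof -
        have "s b - r < c b \<and> c b < s b + r" for b
          using s(2)[of b] by linarith
        then show ?thesis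
          using ext by (auto simp: box_def PiE_def)
      qed
      ultimately show "c \<in> (\<Union>(c, r)\<in>I. box c r)"
        by blast
    qed
  qed
  finally show "(\<lambda>c. \<Sum>b\<in>B. c b *\<^sub>R b) -` U \<inter> space (Pi\<^sub>M B (\<lambda>_. lborel))
      \<in> sets (Pi\<^sub>M B (\<lambda>_. lborel))"
    unfolding G_def .
qed

end

lemma PiM_lborel_translation_invariant:
  fixes k :: "'i \<Rightarrow> real"
  assumes "finite I"
  shows "distr (Pi\<^sub>M I (\<lambda>_. lborel)) (Pi\<^sub>M I (\<lambda>_. lborel)) (\<lambda>c. \<lambda>i\<in>I. k i + c i)
    = Pi\<^sub>M I (\<lambda>_. lborel)"
proof -
  interpret product_sigma_finite "\<lambda>_::'i. lborel :: real measure"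
    by unfold_locales
  have shift: "(\<lambda>c. \<lambda>i\<in>I. k i + c i)
      \<in> measurable (Pi\<^sub>M I (\<lambda>_. lborel)) (Pi\<^sub>M I (\<lambda>_. lborel))"
    by measurable
  show ?thesis
  proof (rule PiM_eqI[OF assms])
    fix A :: "'i \<Rightarrow> real set"
    assume A: "\<And>i. i \<in> I \<Longrightarrow> A i \<in> sets lborel"
    have "emeasure (distr (Pi\<^sub>M I (\<lambda>_. lborel)) (Pi\<^sub>M I (\<lambda>_. lborel)) (\<lambda>c. \<lambda>i\<in>I. k i + c i)) (PiE I A)
        = emeasure (Pi\<^sub>M I (\<lambda>_. lborel))
            ((\<lambda>c. \<lambda>i\<in>I. k i + c i) -` PiE I A \<inter> space (Pi\<^sub>M I (\<lambda>_. lborel)))"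
      using A assms by (intro emeasure_distr shift sets_PiM_I_finite) auto
    also have "(\<lambda>c. \<lambda>i\<in>I. k i + c i) -` PiE I A \<inter> space (Pi\<^sub>M I (\<lambda>_. lborel))
        = PiE I (\<lambda>i. (+) (k i) -` A i)"
      by (auto simp: space_PiM PiE_def Pi_def)
    also have "emeasure (Pi\<^sub>M I (\<lambda>_. lborel)) \<dots> = (\<Prod>i\<in>I. emeasure lborel ((+) (k i) -` A i))"
      using A assms by (intro emeasure_PiM) (auto intro!: measurable_sets_borel[of "(+) _" borel])
    also have "\<dots> = (\<Prod>i\<in>I. emeasure lborel (A i))"
    proof (rule prod.cong)
      fix i assume "i \<in> I"
      then have "emeasure (distr lborel borel ((+) (k i))) (A i)
          = emeasure lborel ((+) (k i) -` A i \<inter> space lborel)"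
        using A by (intro emeasure_distr) auto
      then show "emeasure lborel ((+) (k i) -` A i) = emeasure lborel (A i)"
        by (simp add: lborel_distr_plus)
    qed simp
    finally show "emeasure (distr (Pi\<^sub>M I (\<lambda>_. lborel)) (Pi\<^sub>M I (\<lambda>_. lborel))
        (\<lambda>c. \<lambda>i\<in>I. k i + c i)) (PiE I A) = (\<Prod>i\<in>I. emeasure lborel (A i))" .
  qed simp
qed

context finite_basis
begin

text \<open>
  Let $N'$ be the set of coordinates of points of $N$.  Its translates along $q$ all have the
  same measure, so the set of all $(t, c)$ with $c$ in the translate of $N'$ by $- t q$ has measure
  $\infty \cdot |N'|$.  Slicing the other way, each $c$ contributes the set of all $t$ at which a line in
  direction $q$ meets $N$, which is finite.  Hence $|N'| = 0$ by Tonelli's theorem.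
\<close>
lemma null_if_null_on_parallel_lines:
  fixes q :: 'v
  assumes N: "N \<in> sets borel" and q: "\<And>p. finite {t. p + t *\<^sub>R q \<in> N}"
  shows "N \<in> null_sets (lebesgue_basis B)"
proof -
  let ?P = "Pi\<^sub>M B (\<lambda>_. lborel :: real measure)"
  interpret product_sigma_finite "\<lambda>_::'v. lborel :: real measure"
    by unfold_locales
  interpret product: sigma_finite_measure ?P
    by (rule sigma_finite[OF finite_B])
  interpret pair_sigma_finite "lborel :: real measure" ?P
    by unfold_locales
  define G where "G c = (\<Sum>b\<in>B. c b *\<^sub>R b)" for c :: "'v \<Rightarrow> real"
  have G: "G \<in> measurable ?P borel"
    using combination_measurable by (simp add: G_def[abs_def])
  define N' where "N' = G -` N \<inter> space ?P"
  have N': "N' \<in> sets ?P"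
    unfolding N'_def using G N by (rule measurable_sets)
  define S where "S t c = (\<lambda>b\<in>B. t * coord b q + c b)" for t and c :: "'v \<Rightarrow> real"
  have G_S: "G (S t c) = G c + t *\<^sub>R q" for t c
  proof -
    have "G (S t c) = G c + t *\<^sub>R (\<Sum>b\<in>B. coord b q *\<^sub>R b)"
      by (simp add: G_def S_def scaleR_add_left sum.distrib scaleR_sum_right)
    then show ?thesis
      by (simp add: sum_coord)
  qed
  have S: "(\<lambda>(t, c). S t c) \<in> measurable (lborel \<Otimes>\<^sub>M ?P) ?P"
    unfolding S_def case_prod_beta by measurable
  define Y where "Y = (\<lambda>(t, c). S t c) -` N' \<inter> space (lborel \<Otimes>\<^sub>M ?P)"
  have Y: "Y \<in> sets (lborel \<Otimes>\<^sub>M ?P)"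
    unfolding Y_def using S N' by (rule measurable_sets)
  have "emeasure ?P (Pair t -` Y) = emeasure ?P N'" for t
  proof -
    have "S t \<in> measurable ?P ?P"
      unfolding S_def by measurable
    then have "emeasure (distr ?P ?P (S t)) N' = emeasure ?P (S t -` N' \<inter> space ?P)"
      using N' by (rule emeasure_distr)
    moreover have "distr ?P ?P (S t) = ?P"
      unfolding S_def using PiM_lborel_translation_invariant[OF finite_B] .
    moreover have "S t -` N' \<inter> space ?P = Pair t -` Y"
      by (auto simp: Y_def space_pair_measure)
    ultimately show ?thesis
      by simp
  qed
  then have "emeasure (lborel \<Otimes>\<^sub>M ?P) Y = emeasure ?P N' * \<infinity>"
    using product.emeasure_pair_measure_alt[OF Y] by simp
  moreover have "emeasure (lborel \<Otimes>\<^sub>M ?P) Y = 0"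
  proof -
    have "emeasure lborel ((\<lambda>t. (t, c)) -` Y) = 0" for c
    proof (rule emeasure_lborel_countable)
      have "(\<lambda>t. (t, c)) -` Y \<subseteq> {t. G c + t *\<^sub>R q \<in> N}"
        by (auto simp: Y_def N'_def G_S)
      then show "countable ((\<lambda>t. (t, c)) -` Y)"
        using countable_finite[OF q[of "G c"]] by (rule countable_subset)
    qed
    then show ?thesis
      using emeasure_pair_measure_alt2[OF Y] by simp
  qed
  ultimately have "emeasure ?P N' = 0"
    by (simp add: ennreal_mult_eq_top_iff) 
  then have "emeasure (distr ?P borel G) N = 0"
    using G N by (simp add: emeasure_distr N'_def)
  then have "N \<in> null_sets (distr ?P borel G)"
    using N by (simp add: null_sets_def)
  then show ?thesis
    unfolding lebesgue_basis_def G_def[abs_def] by (rule null_sets_completionI)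
qed

end

section \<open>Density, openness and measure\<close>

text \<open>
  The direction $q$ that is good for all base points serves twice: a placement is the limit of
  full ones along its line in direction $q$, and the non-full placements are a closed set
  that meets every such line in a finite set.
\<close>
theorem proposition3p12:
  fixes d :: nat
  assumes "\<exists>B :: 'a::real_normed_vector set. finite B \<and> span B = UNIV"
    and "dim (UNIV :: 'a set) = d"
    and "d + 1 \<le> CARD('s::finite)"
  shows "open (Full :: ('a ^ 's) set)
    \<and> closure (Full :: ('a ^ 's) set) = UNIV
    \<and> (\<forall>B :: ('a ^ 's) set. independent B \<and> span B = UNIV \<longrightarrow>
          UNIV - Full \<in> null_sets (lebesgue_basis B))"
proof -
  obtain B0 :: "'a set" where B0: "finite B0" "span B0 = UNIV"
    using assms(1) by blast
  obtain B :: "'a set" where B: "B \<subseteq> B0" "independent B" "B0 \<subseteq> span B"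
    using real_vector.maximal_independent_subset[of B0] by blast
  have "span B0 \<subseteq> span B"
    using B(3) by (metis real_vector.span_mono real_vector.span_span)
  then have span_B: "span B = UNIV"
    using B0 by auto
  interpret finite_basis B
    using B0(1) B span_B by unfold_locales (auto intro: finite_subset)
  have "dim (UNIV :: 'a set) = card B"
    using B(2) span_B by (intro real_vector.dim_eq_card) auto
  with assms have "card B + 1 \<le> CARD('s)"
    by simp
  then obtain q :: "'a ^ 's" where q: "\<And>p. finite {t. p + t *\<^sub>R q \<notin> Full}"
    using infinitesimally_free_generic_on_lines unfolding Full_eq by auto
  have opn: "open (Full :: ('a ^ 's) set)"
    unfolding Full_eq by (rule open_infinitesimally_free)
  have dense: "closure (Full :: ('a ^ 's) set) = UNIV"
  proof -
    have "p \<in> closure Full" for p :: "'a ^ 's"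
      unfolding closure_approachable
    proof (intro allI impI)
      fix e :: real
      assume e: "e > 0"
      define \<delta> where "\<delta> = e / (norm q + 1)"
      have \<delta>: "\<delta> > 0"
        using e by (simp add: \<delta>_def add_nonneg_pos)
      then have "infinite ({0<..<\<delta>} - {t. p + t *\<^sub>R q \<notin> Full})"
        using q[of p] by (intro Diff_infinite_finite) auto
      then have "{0<..<\<delta>} - {t. p + t *\<^sub>R q \<notin> Full} \<noteq> {}"
        by (rule infinite_imp_nonempty)
      then obtain t where t: "0 < t" "t < \<delta>" "p + t *\<^sub>R q \<in> Full"
        by auto
      have "norm (t *\<^sub>R q) \<le> t * (norm q + 1)"
        using t(1) by simp
      also have "\<dots> < \<delta> * (norm q + 1)"
        using t(2) by (intro mult_strict_right_mono) (auto simp: add_nonneg_pos)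
      also have "\<dots> = e"
        using norm_ge_zero[of q] by (simp add: \<delta>_def add_nonneg_eq_0_iff)
      finally show "\<exists>y\<in>Full. dist y p < e"
        using t(3) by (intro bexI[of _ "p + t *\<^sub>R q"]) (simp add: dist_norm)
    qed
    then show ?thesis
      by auto
  qed
  have "UNIV - Full \<in> null_sets (lebesgue_basis C)"
    if C: "independent C" "span C = UNIV" for C :: "('a ^ 's) set"
  proof -
    have "finite C"
      using C(1) by (rule independent_placements_finite)
    with C interpret placements: finite_basis C
      by unfold_locales
    show ?thesis
      using opn q by (intro placements.null_if_null_on_parallel_lines[of _ q]) auto
  qed
  with opn dense show ?thesis
    by blast
qed

end
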